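(* The bijection $\Phi^\Pi\colon R\to\widehat I$ does not depend on the choice of the simple root system $\Pi$ compatible with $C$; that is, $\Phi^{\Pi}=\Phi^{\Pi'}$ for any two simple root systems $\Pi,\Pi'$ compatible with $C$.
   Context: $R\subset E$ is a reduced, irreducible, simply-laced root system (type $A,D,E$) of rank $r$ in a Euclidean space $E$ with $W$-invariant inner product $(\cdot,\cdot)$ normalized so that $(\alpha,\alpha)=2$ for $\alpha\in R$; $W$ is its Weyl group. A simple root system $\Pi\subset R$ is a base of $R$. There is a fixed index set $I$ and, for each simple root system $\Pi$, a bijection $I\to\Pi$, $i\mapsto\alpha_i^\Pi$, such that $w(\alpha_i^\Pi)=\alpha_i^{w(\Pi)}$ for all $w\in W$. For $i\ne j$ put $n_{ij}=-(\alpha_i^\Pi,\alpha_j^\Pi)\in\{0,1\}$ (independent of $\Pi$); $I$ also denotes the Dynkin diagram, the graph with vertex set $I$ and $n_{ij}$ edges between $i$ and $j$. Let $s_i^\Pi$ be the reflection in $\alpha_i^\Pi$. A Coxeter element is a product, in some order, of all the simple reflections of some simple root system, each taken once. A Coxeter element $C$ is fixed; $h$ is its order. $\Pi$ is compatible with $C$ if $C=s^\Pi_{i_1}\cdots s^\Pi_{i_r}$ for some enumeration $i_1,\dots,i_r$ of $I$. For compatible $\Pi$, the orientation $\Omega_\Pi$ of $I$ is: for $n_{ij}=1$, $i\to j$ if $s_i^\Pi$ precedes $s_j^\Pi$ in such an expression for $C$ (independent of the expression). Write $i\leqslant j$ if there is an oriented path (possibly of length $0$) from $i$ to $j$ in $\Omega_\Pi$,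 and set $\beta_i^\Pi=\sum_{j\leqslant i}\alpha_j^\Pi$. The $C$-orbit of $\beta_i^\Pi$ does not depend on the choice of $\Pi$ compatible with $C$. Fix $p\colon I\to\mathbb Z_2$ with $p(i)=p(j)+1$ whenever $i,j$ are connected by an edge, and let $\widehat I=\{(i,n)\in I\times\mathbb Z_{2h}\mid p(i)+n\equiv 0 \bmod 2\}$, with $\tau(i,n)=(i,n+2)$. Fix $i_0\in I$ and a bijection $\Phi_0$ from the $C$-orbit of $\beta_{i_0}^\Pi$ onto $\{(i_0,n)\in\widehat I\}$ with $\Phi_0(C\beta)=\tau\Phi_0(\beta)$ (the choice of $i_0,\Phi_0$ is independent of $\Pi$). For $\Pi$ compatible with $C$, $\Phi^\Pi\colon R\to\widehat I$ is the unique bijection such that: $\Phi^\Pi(C\beta)=\tau\Phi^\Pi(\beta)$ for all $\beta\in R$; $\Phi^\Pi(\beta_i^\Pi)\in\{i\}\times\mathbb Z_{2h}$ for all $i\in I$; if $i\to j$ in $\Omega_\Pi$ and $\Phi^\Pi(\beta_i^\Pi)=(i,n)$ then $\Phi^\Pi(\beta_j^\Pi)=(j,n+1)$; and $\Phi^\Pi=\Phi_0$ on the $C$-orbit of $\beta_{i_0}^\Pi$. *)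

theory Defs
  imports "HOL-Analysis.Analysis" "HOL-Library.Z2"
begin

definition refl_root :: "'a::real_inner \<Rightarrow> 'a \<Rightarrow> 'a" where
  "refl_root a x = x - (2 * (x \<bullet> a) / (a \<bullet> a)) *\<^sub>R a"

definition root_system :: "'a::euclidean_space set \<Rightarrow> bool" where
  "root_system R \<longleftrightarrow>
     finite R \<and> span R = UNIV \<and> 0 \<notin> R \<and>
     (\<forall>a\<in>R. refl_root a ` R \<subseteq> R) \<and>
     (\<forall>a\<in>R. \<forall>b\<in>R. 2 * (b \<bullet> a) / (a \<bullet> a) \<in> \<int>)"

definition reduced_rs :: "'a::euclidean_space set \<Rightarrow> bool" where
  "reduced_rs R \<longleftrightarrow> (\<forall>a\<in>R. \<forall>c::real. c *\<^sub>R a \<in> R \<longrightarrow> c = 1 \<or> c = -1)"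

definition irreducible_rs :: "'a::euclidean_space set \<Rightarrow> bool" where
  "irreducible_rs R \<longleftrightarrow>
     R \<noteq> {} \<and>
     \<not> (\<exists>A B. A \<noteq> {} \<and> B \<noteq> {} \<and> A \<union> B = R \<and> A \<inter> B = {} \<and> (\<forall>a\<in>A. \<forall>b\<in>B. a \<bullet> b = 0))"

text \<open>The inner product of the ambient type plays the role of the invariant inner product, in
  the normalization in which all roots (of the simply-laced system) have square length 2.\<close>

definition simply_laced_normalized :: "'a::euclidean_space set \<Rightarrow> bool" where
  "simply_laced_normalized R \<longleftrightarrow> (\<forall>a\<in>R. a \<bullet> a = 2)"

inductive_set weyl_group :: "'a::euclidean_space set \<Rightarrow> ('a \<Rightarrow> 'a) set" for R where
  id: "id \<in> weyl_group R"
| refl: "a \<in> R \<Longrightarrow> w \<in> weyl_group R \<Longrightarrow> refl_root a \<circ> w \<in> weyl_group R"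

definition simple_system :: "'a::euclidean_space set \<Rightarrow> 'a set \<Rightarrow> bool" where
  "simple_system R P \<longleftrightarrow>
     P \<subseteq> R \<and> independent P \<and> span P = UNIV \<and>
     (\<forall>b\<in>R. \<exists>c :: 'a \<Rightarrow> int. b = (\<Sum>a\<in>P. of_int (c a) *\<^sub>R a) \<and>
        ((\<forall>a\<in>P. c a \<ge> 0) \<or> (\<forall>a\<in>P. c a \<le> 0)))"

text \<open>\<open>\<alpha> P i\<close> is the simple root of the simple system \<open>P\<close> with index \<open>i\<close>.\<close>

definition simple_root_indexing ::
    "'a::euclidean_space set \<Rightarrow> 'i set \<Rightarrow> ('a set \<Rightarrow> 'i \<Rightarrow> 'a) \<Rightarrow> bool" where
  "simple_root_indexing R I \<alpha> \<longleftrightarrow>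
     (\<forall>P. simple_system R P \<longrightarrow> bij_betw (\<alpha> P) I P) \<and>
     (\<forall>P. simple_system R P \<longrightarrow>
        (\<forall>w\<in>weyl_group R. \<forall>i\<in>I. w (\<alpha> P i) = \<alpha> (w ` P) i))"

definition edge_number :: "('a::euclidean_space set \<Rightarrow> 'i \<Rightarrow> 'a) \<Rightarrow> 'a set \<Rightarrow> 'i \<Rightarrow> 'i \<Rightarrow> real" where
  "edge_number \<alpha> P i j = - (\<alpha> P i \<bullet> \<alpha> P j)"

text \<open>The product \<open>refl_root a\<^sub>1 \<circ> \<dots> \<circ> refl_root a\<^sub>k\<close>; as operators, the last reflection acts
  first.\<close>

definition refl_product :: "'a::euclidean_space list \<Rightarrow> 'a \<Rightarrow> 'a" where
  "refl_product as = foldr (\<lambda>a f. refl_root a \<circ> f) as id"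

definition coxeter_element :: "'a::euclidean_space set \<Rightarrow> ('a \<Rightarrow> 'a) \<Rightarrow> bool" where
  "coxeter_element R C \<longleftrightarrow>
     (\<exists>P as. simple_system R P \<and> distinct as \<and> set as = P \<and> C = refl_product as)"

definition map_order :: "('a \<Rightarrow> 'a) \<Rightarrow> nat" where
  "map_order C = (LEAST n. 0 < n \<and> C ^^ n = id)"

text \<open>\<open>is\<close> enumerates \<open>I\<close> and expresses \<open>C\<close> as a product of the simple reflections of \<open>P\<close>.\<close>

definition coxeter_expression ::
    "'i set \<Rightarrow> ('a::euclidean_space set \<Rightarrow> 'i \<Rightarrow> 'a) \<Rightarrow> ('a \<Rightarrow> 'a) \<Rightarrow> 'a set \<Rightarrow> 'i list \<Rightarrow> bool" where
  "coxeter_expression I \<alpha> C P is \<longleftrightarrow>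
     distinct is \<and> set is = I \<and> C = refl_product (map (\<alpha> P) is)"

definition compatible ::
    "'a::euclidean_space set \<Rightarrow> 'i set \<Rightarrow> ('a set \<Rightarrow> 'i \<Rightarrow> 'a) \<Rightarrow> ('a \<Rightarrow> 'a) \<Rightarrow> 'a set \<Rightarrow> bool" where
  "compatible R I \<alpha> C P \<longleftrightarrow> simple_system R P \<and> (\<exists>is. coxeter_expression I \<alpha> C P is)"

text \<open>The relative order of two adjacent indices is the same in all expressions of \<open>C\<close>, so it does
  not matter that the following definition asks for some expression.\<close>

definition arrow ::
    "'i set \<Rightarrow> ('a::euclidean_space set \<Rightarrow> 'i \<Rightarrow> 'a) \<Rightarrow> ('a \<Rightarrow> 'a) \<Rightarrow> 'a set \<Rightarrow> 'i \<Rightarrow> 'i \<Rightarrow> bool" where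
  "arrow I \<alpha> C P i j \<longleftrightarrow>
     i \<in> I \<and> j \<in> I \<and> i \<noteq> j \<and> edge_number \<alpha> P i j = 1 \<and>
     (\<exists>is k l. coxeter_expression I \<alpha> C P is \<and> k < l \<and> l < length is \<and> is ! k = i \<and> is ! l = j)"

definition beta ::
    "'i set \<Rightarrow> ('a::euclidean_space set \<Rightarrow> 'i \<Rightarrow> 'a) \<Rightarrow> ('a \<Rightarrow> 'a) \<Rightarrow> 'a set \<Rightarrow> 'i \<Rightarrow> 'a" where
  "beta I \<alpha> C P i = (\<Sum>j\<in>{j\<in>I. (arrow I \<alpha> C P)\<^sup>*\<^sup>* j i}. \<alpha> P j)"

text \<open>As \<open>C\<close> has finite order, non-negative powers suffice.\<close>

definition C_orbit :: "('a \<Rightarrow> 'a) \<Rightarrow> 'a \<Rightarrow> 'a set" where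
  "C_orbit C b = {(C ^^ k) b | k. True}"

definition parity_function ::
    "'a::euclidean_space set \<Rightarrow> 'i set \<Rightarrow> ('a set \<Rightarrow> 'i \<Rightarrow> 'a) \<Rightarrow> ('i \<Rightarrow> bit) \<Rightarrow> bool" where
  "parity_function R I \<alpha> p \<longleftrightarrow>
     (\<forall>P. simple_system R P \<longrightarrow>
        (\<forall>i\<in>I. \<forall>j\<in>I. i \<noteq> j \<and> edge_number \<alpha> P i j = 1 \<longrightarrow> p i = p j + 1))"

text \<open>The integers modulo \<open>2h\<close> are represented by the integers in \<open>{0..<2h}\<close>, with addition
  reduced modulo \<open>2h\<close>.\<close>

definition Z2h :: "nat \<Rightarrow> int set" where
  "Z2h h = {0..<2 * int h}"

definition I_hat :: "'i set \<Rightarrow> ('i \<Rightarrow> bit) \<Rightarrow> nat \<Rightarrow> ('i \<times> int) set" where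
  "I_hat I p h = {(i, n). i \<in> I \<and> n \<in> Z2h h \<and> p i + of_int n = 0}"

definition tau :: "nat \<Rightarrow> 'i \<times> int \<Rightarrow> 'i \<times> int" where
  "tau h = (\<lambda>(i, n). (i, (n + 2) mod (2 * int h)))"

text \<open>The orbit of \<open>beta I \<alpha> C P i\<^sub>0\<close> does not depend on the compatible \<open>P\<close>, so any such
  \<open>P\<close> serves to specify it.\<close>

definition base_labelling ::
    "'a::euclidean_space set \<Rightarrow> 'i set \<Rightarrow> ('a set \<Rightarrow> 'i \<Rightarrow> 'a) \<Rightarrow> ('a \<Rightarrow> 'a) \<Rightarrow> ('i \<Rightarrow> bit) \<Rightarrow>
      'i \<Rightarrow> ('a \<Rightarrow> 'i \<times> int) \<Rightarrow> bool" where
  "base_labelling R I \<alpha> C p i\<^sub>0 \<Phi>\<^sub>0 \<longleftrightarrow>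
     (\<exists>P. compatible R I \<alpha> C P \<and>
        bij_betw \<Phi>\<^sub>0 (C_orbit C (beta I \<alpha> C P i\<^sub>0)) {x \<in> I_hat I p (map_order C). fst x = i\<^sub>0} \<and>
        (\<forall>b\<in>C_orbit C (beta I \<alpha> C P i\<^sub>0). \<Phi>\<^sub>0 (C b) = tau (map_order C) (\<Phi>\<^sub>0 b)))"

text \<open>\<open>is_Phi R I \<alpha> C p i\<^sub>0 \<Phi>\<^sub>0 P \<Phi>\<close>: the restriction of \<open>\<Phi>\<close> to \<open>R\<close> is the bijection
  onto \<open>I_hat\<close> characterized by the compatible simple system \<open>P\<close>. Values of \<open>\<Phi>\<close> outside
  \<open>R\<close> are unconstrained.\<close>

definition is_Phi ::
    "'a::euclidean_space set \<Rightarrow> 'i set \<Rightarrow> ('a set \<Rightarrow> 'i \<Rightarrow> 'a) \<Rightarrow> ('a \<Rightarrow> 'a) \<Rightarrow> ('i \<Rightarrow> bit) \<Rightarrow>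
      'i \<Rightarrow> ('a \<Rightarrow> 'i \<times> int) \<Rightarrow> 'a set \<Rightarrow> ('a \<Rightarrow> 'i \<times> int) \<Rightarrow> bool" where
  "is_Phi R I \<alpha> C p i\<^sub>0 \<Phi>\<^sub>0 P \<Phi> \<longleftrightarrow>
     (let h = map_order C; \<beta> = beta I \<alpha> C P in
       bij_betw \<Phi> R (I_hat I p h) \<and>
       (\<forall>b\<in>R. \<Phi> (C b) = tau h (\<Phi> b)) \<and>
       (\<forall>i\<in>I. \<Phi> (\<beta> i) \<in> {i} \<times> Z2h h) \<and>
       (\<forall>i j n. arrow I \<alpha> C P i j \<and> \<Phi> (\<beta> i) = (i, n) \<longrightarrow>
          \<Phi> (\<beta> j) = (j, (n + 1) mod (2 * int h))) \<and>
       (\<forall>b\<in>C_orbit C (\<beta> i\<^sub>0). \<Phi> b = \<Phi>\<^sub>0 b))"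

end

theory Submission
  imports Defs
begin

text \<open>
  Write \<open>C = s\<^sub>1 \<dots> s\<^sub>r\<close> and let \<open>\<omega>\<^sub>i\<close> be the fundamental weights of the simple system \<open>P\<close>. Then
  \<open>\<beta>\<^sub>i = (1 - C) \<omega>\<^sub>i = s\<^sub>1 \<dots> s\<^sub>i\<^sub>-\<^sub>1 \<alpha>\<^sub>i\<close>. Reflecting \<open>P\<close> in a source \<open>i\<close> gives another simple system
  compatible with \<open>C\<close>, whose \<open>\<beta>\<close>s are the same except that \<open>\<beta>\<^sub>i\<close> is replaced by \<open>C \<beta>\<^sub>i\<close>; such a move
  does not change \<open>\<Phi>\<close>. So it suffices to move \<open>P\<close> and \<open>P'\<close> to a common simple system.

  As the diagram is a forest, sources can be reflected until the orientation is bipartite. Let \<open>s\<close> be a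
  height function, with \<open>s\<^sub>j = s\<^sub>i + 1\<close> for \<open>i \<rightarrow> j\<close>, and \<open>g > 0\<close> the Perron eigenvector of the adjacency
  matrix, with eigenvalue \<open>2 cos \<theta>\<close>. Then \<open>f(\<beta>\<^sub>k) = exp(\<i> \<theta> s\<^sub>k) g\<^sub>k\<close> defines a linear \<open>f\<close> with values in the
  complex numbers and \<open>f \<circ> C = exp(2 \<i> \<theta>) f\<close>, the projection to the Coxeter plane. By the uniqueness of
  Perron eigenvectors, \<open>f\<close> depends only on \<open>C\<close>, up to a scalar. For a bipartite
  orientation \<open>f\<close> maps all simple roots onto two rays, which turn by \<open>\<theta>\<close> when all sources are reflected,
  so \<open>P\<close> and \<open>P'\<close> can be turned until one half-plane contains the simple roots of both. Simple systems
  with a common positive functional coincide.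
\<close>

section \<open>Reflections and simple systems\<close>

lemma linear_refl_root: "linear (refl_root a)"
  unfolding refl_root_def
  by (rule linearI) (auto simp: inner_add_left inner_scaleR_left algebra_simps add_divide_distrib)

lemma refl_root_norm_two: "a \<bullet> a = 2 \<Longrightarrow> refl_root a x = x - (x \<bullet> a) *\<^sub>R a"
  by (simp add: refl_root_def)

lemma refl_root_involutive: "a \<noteq> 0 \<Longrightarrow> refl_root a (refl_root a x) = x"
  by (simp add: refl_root_def inner_diff_left algebra_simps)

lemma inner_refl_root: "a \<noteq> 0 \<Longrightarrow> refl_root a x \<bullet> refl_root a y = x \<bullet> y"
  by (simp add: refl_root_def inner_diff_left inner_diff_right inner_commute field_simps)

lemma refl_root_conjugate:
  assumes "a \<noteq> 0"
  shows "refl_root (refl_root a b) = refl_root a \<circ> refl_root b \<circ> refl_root a"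
proof
  fix x
  have "x \<bullet> refl_root a b = refl_root a x \<bullet> b"
    using inner_refl_root[OF assms, of "refl_root a x" b] by (simp add: refl_root_involutive assms)
  moreover have "refl_root a (refl_root b (refl_root a x)) =
      refl_root a (refl_root a x) - (2 * (refl_root a x \<bullet> b) / (b \<bullet> b)) *\<^sub>R refl_root a b"
    unfolding refl_root_def[of b]
    by (simp add: linear_diff[OF linear_refl_root] linear_cmul[OF linear_refl_root])
  ultimately show "refl_root (refl_root a b) x = (refl_root a \<circ> refl_root b \<circ> refl_root a) x"
    using assms by (simp add: refl_root_def[of "refl_root a b"] inner_refl_root refl_root_involutive)
qed

lemma refl_product_simps [simp]:
  "refl_product [] = id"
  "refl_product (b # bs) = refl_root b \<circ> refl_product bs"
  by (simp_all add: refl_product_def)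

lemma refl_product_append: "refl_product (as @ bs) = refl_product as \<circ> refl_product bs"
  by (induction as) (auto simp: fun_eq_iff)

lemma linear_refl_product: "linear (refl_product as)"
proof (induction as)
  case Nil
  show ?case unfolding refl_product_simps by (rule linear_id)
next
  case (Cons b bs)
  show ?case unfolding refl_product_simps by (rule linear_compose[OF Cons.IH linear_refl_root])
qed

lemma refl_product_conjugate:
  assumes "a \<noteq> 0"
  shows "refl_product (map (refl_root a) bs) = refl_root a \<circ> refl_product bs \<circ> refl_root a"
  by (induction bs) (simp_all add: fun_eq_iff refl_root_conjugate refl_root_involutive assms)

text \<open>A quadratic without constant term that is never negative has its minimum at 0, so its
  derivative \<open>p\<close> there vanishes. This supplies the first-order condition for the
  maximizer in \<open>perron_exists\<close>.\<close>

lemma linear_coeff_zero: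
  fixes p q :: real
  assumes "\<And>t. 0 \<le> t * p + t\<^sup>2 * q"
  shows "p = 0"
proof (rule ccontr)
  assume p: "p \<noteq> 0"
  \<comment> \<open>Any positive \<open>d\<close> larger than \<open>q\<close> works: at
    \<open>t = - p / d\<close> the value is \<open>(p / d)^2 * (q - d) < 0\<close>.\<close>
  define d where "d = 2 * (\<bar>q\<bar> + 1)"
  have d: "d > 0" by (simp add: d_def)
  have "0 \<le> (- p / d) * p + (- p / d)\<^sup>2 * q" by (rule assms)
  also have "\<dots> = (p\<^sup>2 / d\<^sup>2) * (q - d)" using d by (simp add: field_simps power2_eq_square)
  finally have "0 \<le> (p\<^sup>2 / d\<^sup>2) * (q - d)" .
  moreover have "p\<^sup>2 / d\<^sup>2 > 0" "q - d < 0" using p d by (auto simp: d_def)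
  ultimately show False using mult_pos_neg by (metis not_le)
qed

text \<open>The families \<open>a\<close> below are the simple roots indexed by \<open>I\<close>, and \<open>fweight\<close> is the basis dual to them.
  For \<open>C\<close> a product of the simple reflections, \<open>slice_root\<close> is the root \<open>\<beta>\<^sub>i\<close>, in a form that does not refer
  to the order of the factors.\<close>

definition fweight :: "'i set \<Rightarrow> ('i \<Rightarrow> 'a::euclidean_space) \<Rightarrow> 'i \<Rightarrow> 'a" where
  "fweight I a i = (SOME w. \<forall>j\<in>I. w \<bullet> a j = (if j = i then 1 else 0))"

definition nbrs :: "'i set \<Rightarrow> ('i \<Rightarrow> 'a::euclidean_space) \<Rightarrow> 'i \<Rightarrow> 'i set" where
  "nbrs I a i = {j\<in>I. a i \<bullet> a j = -1}"

definition slice_root ::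
    "'i set \<Rightarrow> ('i \<Rightarrow> 'a::euclidean_space) \<Rightarrow> ('a \<Rightarrow> 'a) \<Rightarrow> 'i \<Rightarrow> 'a" where
  "slice_root I a C i = fweight I a i - C (fweight I a i)"

definition factorization ::
    "'i set \<Rightarrow> ('i \<Rightarrow> 'a::euclidean_space) \<Rightarrow> ('a \<Rightarrow> 'a) \<Rightarrow> 'i list \<Rightarrow> bool" where
  "factorization I a C xs \<longleftrightarrow> distinct xs \<and> set xs = I \<and> C = refl_product (map a xs)"

text \<open>The order is recorded through the prefix before \<open>j\<close>, since products over
  such prefixes are what \<open>slice_root_eq_refl_product\<close> evaluates;
  \<open>precedes_nth\<close> translates to positions.\<close>

definition precedes :: "'i list \<Rightarrow> 'i \<Rightarrow> 'i \<Rightarrow> bool" where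
  "precedes xs i j \<longleftrightarrow> (\<exists>us vs. xs = us @ j # vs \<and> i \<in> set us)"

lemma precedes_iff:
  assumes "distinct (us @ i # vs)"
  shows "precedes (us @ i # vs) j i \<longleftrightarrow> j \<in> set us"
proof
  assume "precedes (us @ i # vs) j i"
  then obtain us' vs' where "us @ i # vs = us' @ i # vs'" "j \<in> set us'"
    by (auto simp: precedes_def)
  moreover have "us = us'"
    using calculation(1) assms by (subst (asm) append_Cons_eq_iff) auto
  ultimately show "j \<in> set us" by simp
qed (auto simp: precedes_def)

lemma precedes_total:
  assumes "i \<in> set xs" "j \<in> set xs" "i \<noteq> j"
  shows "precedes xs i j \<or> precedes xs j i"
proof -
  obtain us vs where xs: "xs = us @ i # vs" using assms(1) by (meson split_list)
  show ?thesis
  proof (cases "j \<in> set us")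
    case True then show ?thesis using xs by (auto simp: precedes_def)
  next
    case False
    then have "j \<in> set vs" using assms xs by auto
    then obtain ys zs where "vs = ys @ j # zs" by (meson split_list)
    then have "xs = (us @ i # ys) @ j # zs" using xs by simp
    moreover have "i \<in> set (us @ i # ys)" by simp
    ultimately show ?thesis unfolding precedes_def by blast
  qed
qed

lemma precedes_asym:
  assumes "distinct xs" "precedes xs i j"
  shows "\<not> precedes xs j i"
proof
  assume "precedes xs j i"
  then obtain us vs where xs: "xs = us @ i # vs" "j \<in> set us" by (auto simp: precedes_def)
  then obtain ys zs where us: "us = ys @ j # zs" by (meson split_list)
  then have "xs = ys @ j # (zs @ i # vs)" using xs by simp
  then show False using assms precedes_iff[of ys j "zs @ i # vs" i] by auto
qed

lemma precedes_in_set: "precedes xs i j \<Longrightarrow> i \<in> set xs \<and> j \<in> set xs"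
  by (auto simp: precedes_def)

lemma precedes_Nil [simp]: "\<not> precedes [] i j"
  by (simp add: precedes_def)

lemma precedes_Cons [simp]: "precedes (x # xs) i j \<longleftrightarrow> precedes xs i j \<or> (i = x \<and> j \<in> set xs)"
proof
  assume "precedes (x # xs) i j"
  then obtain us vs where "x # xs = us @ j # vs" "i \<in> set us" by (auto simp: precedes_def)
  then show "precedes xs i j \<or> (i = x \<and> j \<in> set xs)"
    by (cases us) (auto simp: precedes_def)
next
  assume "precedes xs i j \<or> (i = x \<and> j \<in> set xs)"
  then show "precedes (x # xs) i j"
  proof
    assume "precedes xs i j"
    then obtain us vs where "x # xs = (x # us) @ j # vs" "i \<in> set (x # us)" by (auto simp: precedes_def)
    then show ?thesis unfolding precedes_def by blast
  next
    assume *: "i = x \<and> j \<in> set xs"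
    then obtain us vs where "xs = us @ j # vs" by (meson split_list)
    then have "x # xs = (x # us) @ j # vs" "i \<in> set (x # us)" using * by auto
    then show ?thesis unfolding precedes_def by blast
  qed
qed

lemma precedes_append:
  "precedes (xs @ ys) i j \<longleftrightarrow> precedes xs i j \<or> precedes ys i j \<or> (i \<in> set xs \<and> j \<in> set ys)"
  by (induction xs) auto

lemma precedes_nth:
  "precedes xs i j \<longleftrightarrow> (\<exists>k l. k < l \<and> l < length xs \<and> xs ! k = i \<and> xs ! l = j)"
proof
  assume "precedes xs i j"
  then obtain us vs where xs: "xs = us @ j # vs" "i \<in> set us" by (auto simp: precedes_def)
  then obtain k where "k < length us" "us ! k = i" by (auto simp: in_set_conv_nth)
  then show "\<exists>k l. k < l \<and> l < length xs \<and> xs ! k = i \<and> xs ! l = j"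
    using xs by (intro exI[of _ k] exI[of _ "length us"]) (auto simp: nth_append)
next
  assume "\<exists>k l. k < l \<and> l < length xs \<and> xs ! k = i \<and> xs ! l = j"
  then obtain k l where kl: "k < l" "l < length xs" "xs ! k = i" "xs ! l = j" by blast
  then have "xs = take l xs @ j # drop (Suc l) xs" "i \<in> set (take l xs)"
    using id_take_nth_drop[of l xs] by (auto simp: in_set_conv_nth intro!: exI[of _ k])
  then show "precedes xs i j" unfolding precedes_def by blast
qed

section \<open>Weights, coordinates and the Cartan matrix of a simple system\<close>

locale simply_laced_base =
  fixes R :: "'a::euclidean_space set" and I :: "'i set" and a :: "'i \<Rightarrow> 'a"
  assumes root_system: "root_system R"
    and simply_laced: "simply_laced_normalized R"
    and simple: "simple_system R (a ` I)"
    and inj: "inj_on a I"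
begin

abbreviation "\<omega> \<equiv> fweight I a"
abbreviation "nb \<equiv> nbrs I a"

lemma finite_R: "finite R"
  using root_system by (simp add: root_system_def)

lemma norm_two: "x \<in> R \<Longrightarrow> x \<bullet> x = 2"
  using simply_laced by (simp add: simply_laced_normalized_def)

lemma inner_Ints: "x \<in> R \<Longrightarrow> y \<in> R \<Longrightarrow> x \<bullet> y \<in> \<int>"
  using root_system norm_two[of y] by (force simp: root_system_def)

lemma refl_in_R: "x \<in> R \<Longrightarrow> y \<in> R \<Longrightarrow> refl_root x y \<in> R"
  using root_system by (force simp: root_system_def)

lemma a_in_R: "i \<in> I \<Longrightarrow> a i \<in> R"
  using simple by (auto simp: simple_system_def)

lemma a_norm [simp]: "i \<in> I \<Longrightarrow> a i \<bullet> a i = 2"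
  by (simp add: a_in_R norm_two)

lemma finite_I: "finite I"
  using finite_R inj a_in_R finite_imageD finite_subset by (metis image_subsetI)

lemma indep: "independent (a ` I)" and span_a: "span (a ` I) = UNIV"
  using simple by (auto simp: simple_system_def)

lemma fweight_inner:
  assumes "i \<in> I" "j \<in> I"
  shows "\<omega> i \<bullet> a j = (if j = i then 1 else 0)"
proof -
  obtain g :: "'a \<Rightarrow> real" where g: "linear g" "\<And>x. x \<in> a ` I \<Longrightarrow> g x = (if x = a i then 1 else 0)"
    using linear_independent_extend[OF indep, of "\<lambda>x. if x = a i then 1 else 0"] by blast
  \<comment> \<open>Riesz representation: this vector represents the functional \<open>g\<close>
    dual to \<open>a i\<close>.\<close>
  have "(\<Sum>b\<in>Basis. g b *\<^sub>R b) \<bullet> x = g x" for x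
  proof -
    have "g x = g (\<Sum>b\<in>Basis. (x \<bullet> b) *\<^sub>R b)" by (simp add: euclidean_representation)
    also have "\<dots> = (\<Sum>b\<in>Basis. (x \<bullet> b) * g b)"
      by (simp add: linear_sum[OF g(1)] linear_cmul[OF g(1)])
    finally show ?thesis 
      by (simp add: inner_sum_left inner_commute[of x] mult.commute)
  qed
  then have "\<exists>w. \<forall>j\<in>I. w \<bullet> a j = (if j = i then 1 else 0)"
    using g(2) inj assms by (metis (no_types, lifting) imageI inj_onD)
  then have "\<forall>j\<in>I. \<omega> i \<bullet> a j = (if j = i then 1 else 0)"
    unfolding fweight_def by (rule someI_ex)
  with assms show ?thesis by blast
qed

lemma eq_if_inner_eq:
  assumes "\<And>j. j \<in> I \<Longrightarrow> x \<bullet> a j = y \<bullet> a j"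
  shows "x = y"
proof -
  have "orthogonal (x - y) z" if "z \<in> span (a ` I)" for z
    using that
    by (rule orthogonal_to_span) (use assms in \<open>auto simp: orthogonal_def inner_diff_left\<close>)
  then have "orthogonal (x - y) (x - y)" using span_a by blast
  then show ?thesis by (simp add: orthogonal_def)
qed

lemma fweight_unique:
  assumes "i \<in> I" "\<And>j. j \<in> I \<Longrightarrow> w \<bullet> a j = (if j = i then 1 else 0)"
  shows "w = \<omega> i"
  by (rule eq_if_inner_eq) (simp add: assms fweight_inner)

lemma fweight_expansion: "x = (\<Sum>i\<in>I. (x \<bullet> a i) *\<^sub>R \<omega> i)"
proof (rule eq_if_inner_eq)
  fix j assume j: "j \<in> I"
  have "(\<Sum>i\<in>I. (x \<bullet> a i) *\<^sub>R \<omega> i) \<bullet> a j = (\<Sum>i\<in>I. (x \<bullet> a i) * (if j = i then 1 else 0))"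
    unfolding inner_sum_left using j by (intro sum.cong) (auto simp: fweight_inner)
  then show "x \<bullet> a j = (\<Sum>i\<in>I. (x \<bullet> a i) *\<^sub>R \<omega> i) \<bullet> a j"
    using j finite_I by (simp add: if_distrib cong: if_cong)
qed

lemma coord_sum:
  assumes "i \<in> I"
  shows "\<omega> i \<bullet> (\<Sum>j\<in>I. c j *\<^sub>R a j) = c i"
proof -
  have "\<omega> i \<bullet> (\<Sum>j\<in>I. c j *\<^sub>R a j) = (\<Sum>j\<in>I. c j * (if j = i then 1 else 0))"
    unfolding inner_sum_right using assms by (intro sum.cong) (auto simp: fweight_inner)
  then show ?thesis using assms finite_I by (simp add: if_distrib cong: if_cong)
qed

lemma in_sum_form: "\<exists>c. x = (\<Sum>i\<in>I. c i *\<^sub>R a i)"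
proof -
  have "x \<in> span (a ` I)" using span_a by simp
  then obtain u where "x = (\<Sum>v\<in>a ` I. u v *\<^sub>R v)"
    using finite_I by (auto simp: span_finite)
  then show ?thesis using inj by (auto simp: sum.reindex intro!: exI[of _ "u \<circ> a"])
qed

lemma coord_expansion: "x = (\<Sum>i\<in>I. (\<omega> i \<bullet> x) *\<^sub>R a i)"
proof -
  obtain c where c: "x = (\<Sum>i\<in>I. c i *\<^sub>R a i)" using in_sum_form by blast
  then have "\<omega> i \<bullet> x = c i" if "i \<in> I" for i using coord_sum[OF that, of c] by simp
  then have "(\<Sum>i\<in>I. (\<omega> i \<bullet> x) *\<^sub>R a i) = (\<Sum>i\<in>I. c i *\<^sub>R a i)" by (intro sum.cong) auto
  with c show ?thesis by simp
qed

lemma root_coords: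
  assumes "y \<in> R"
  shows "\<omega> i \<bullet> y \<in> \<int> \<or> i \<notin> I"
    and "(\<forall>i\<in>I. \<omega> i \<bullet> y \<ge> 0) \<or> (\<forall>i\<in>I. \<omega> i \<bullet> y \<le> 0)"
proof -
  obtain c :: "'a \<Rightarrow> int" where c: "y = (\<Sum>x\<in>a ` I. of_int (c x) *\<^sub>R x)"
      "(\<forall>x\<in>a ` I. c x \<ge> 0) \<or> (\<forall>x\<in>a ` I. c x \<le> 0)"
    using simple assms unfolding simple_system_def by blast
  have "y = (\<Sum>i\<in>I. of_int (c (a i)) *\<^sub>R a i)" using c(1) inj by (simp add: sum.reindex)
  then have *: "\<omega> i \<bullet> y = of_int (c (a i))" if "i \<in> I" for i using coord_sum[OF that] by simp
  show "\<omega> i \<bullet> y \<in> \<int> \<or> i \<notin> I" using * by auto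
  show "(\<forall>i\<in>I. \<omega> i \<bullet> y \<ge> 0) \<or> (\<forall>i\<in>I. \<omega> i \<bullet> y \<le> 0)" using c(2) * by auto
qed

text \<open>The vectors \<open>x - y\<close> and \<open>x + y\<close> have positive square length,
  which puts the inner product strictly between -2 and 2; integrality does the rest.\<close>

lemma root_inner_bound:
  assumes "x \<in> R" "y \<in> R" "x \<noteq> y" "x \<noteq> - y"
  shows "x \<bullet> y \<in> {-1, 0, 1}"
proof -
  obtain k :: int where k: "x \<bullet> y = of_int k" using inner_Ints assms Ints_cases by metis
  have "(x - y) \<bullet> (x - y) > 0" "(x + y) \<bullet> (x + y) > 0"
    using assms by (auto simp: add_eq_0_iff)
  then have "- 2 < x \<bullet> y" "x \<bullet> y < 2"
    using norm_two assms by (auto simp: inner_add_left inner_add_right inner_diff_left inner_diff_right inner_commute)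
  then have "k \<in> {-1, 0, 1}" using k by auto
  then show ?thesis using k by auto
qed

text \<open>If the inner product were 1, a reflection would make \<open>a i - a j\<close> a root
  with coordinates of both signs.\<close>

lemma simple_inner:
  assumes "i \<in> I" "j \<in> I" "i \<noteq> j"
  shows "a i \<bullet> a j \<in> {-1, 0}"
proof -
  have ne: "a i \<noteq> a j" using assms inj by (meson inj_onD)
  have "a i \<noteq> - a j"
  proof
    assume "a i = - a j"
    then have "\<omega> i \<bullet> a i = - (\<omega> i \<bullet> a j)" by simp
    then show False using assms by (simp add: fweight_inner)
  qed
  moreover have "a i \<bullet> a j \<noteq> 1"
  proof
    assume "a i \<bullet> a j = 1"
    then have "refl_root (a j) (a i) = a i - a j" using assms by (simp add: refl_root_norm_two)
    then have "a i - a j \<in> R" using refl_in_R a_in_R assms by metis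
    then show False using root_coords(2)[of "a i - a j"] assms
      by (auto simp: inner_diff_right fweight_inner split: if_splits)
  qed
  ultimately show ?thesis using root_inner_bound[OF a_in_R a_in_R] assms ne by blast
qed

lemma nb_subset: "nb i \<subseteq> I" and finite_nb: "finite (nb i)"
  using finite_I by (auto simp: nbrs_def)

lemma nb_sym: "i \<in> I \<Longrightarrow> j \<in> nb i \<Longrightarrow> i \<in> nb j"
  by (auto simp: nbrs_def inner_commute)

lemma nb_irrefl: "i \<notin> nb i"
  by (auto simp: nbrs_def)

lemma simple_inner_cases:
  assumes "i \<in> I" "j \<in> I"
  shows "a i \<bullet> a j = (if i = j then 2 else if j \<in> nb i then -1 else 0)"
  using simple_inner[OF assms] assms by (auto simp: nbrs_def)

text \<open>The Cartan matrix is twice the identity minus the adjacency matrix. The values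
  \<open>u\<close> are vectors because the formula is applied to real coordinates and to the slice
  roots alike.\<close>

lemma cartan_sum:
  fixes u :: "'i \<Rightarrow> 'b::real_vector"
  assumes "i \<in> I"
  shows "(\<Sum>j\<in>I. (a i \<bullet> a j) *\<^sub>R u j) = 2 *\<^sub>R u i - (\<Sum>j\<in>nb i. u j)"
proof -
  have "(\<Sum>j\<in>I. (a i \<bullet> a j) *\<^sub>R u j) = (\<Sum>j\<in>I. (if j = i then 2 *\<^sub>R u j else 0) - (if j \<in> nb i then u j else 0))"
    using assms nb_irrefl by (intro sum.cong) (auto simp: simple_inner_cases)
  also have "\<dots> = 2 *\<^sub>R u i - (\<Sum>j\<in>nb i. u j)"
    using assms finite_I nb_subset[of i]
    by (simp add: sum_subtractf sum.delta sum.If_cases Int_absorb1 Int_commute)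
  finally show ?thesis .
qed

lemma inner_simple:
  assumes "i \<in> I"
  shows "x \<bullet> a i = 2 * (\<omega> i \<bullet> x) - (\<Sum>j\<in>nb i. \<omega> j \<bullet> x)"
proof -
  have "x \<bullet> a i = (\<Sum>j\<in>I. (a i \<bullet> a j) *\<^sub>R (\<omega> j \<bullet> x))"
    by (subst (1) coord_expansion[of x])
      (simp add: inner_sum_left mult.commute inner_commute[of "a _" "a i"])
  then show ?thesis using cartan_sum[OF assms, of "\<lambda>j. \<omega> j \<bullet> x"] by simp
qed

section \<open>Factorizations of a Coxeter element\<close>

lemma refl_product_fweight:
  assumes "i \<in> I" "set xs \<subseteq> I - {i}"
  shows "refl_product (map a xs) (\<omega> i) = \<omega> i"
  using assms(2)
proof (induction xs)
  case (Cons x xs)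
  then show ?case using assms(1) by (auto simp: refl_root_norm_two fweight_inner)
qed simp

lemma factorization_split:
  "factorization I a C xs \<Longrightarrow> i \<in> I \<Longrightarrow> \<exists>us vs. xs = us @ i # vs"
  unfolding factorization_def using split_list by metis

lemma linear_factorization: "factorization I a C xs \<Longrightarrow> linear C"
  by (simp add: factorization_def linear_refl_product)

text \<open>Only the factor at \<open>i\<close> moves the weight \<open>\<omega> i\<close>: the
  reflections to its right fix it, the one at \<open>i\<close> subtracts \<open>a i\<close>, and
  those to its left fix \<open>\<omega> i\<close> again and act on \<open>a i\<close> alone.\<close>

lemma slice_root_eq_refl_product:
  assumes "factorization I a C (us @ i # vs)"
  shows "slice_root I a C i = refl_product (map a us) (a i)"
proof -
  have i: "i \<in> I" and us: "set us \<subseteq> I - {i}" and vs: "set vs \<subseteq> I - {i}"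
    using assms by (auto simp: factorization_def)
  have "C (\<omega> i) = refl_product (map a us) (refl_root (a i) (refl_product (map a vs) (\<omega> i)))"
    using assms by (simp add: factorization_def refl_product_append)
  also have "\<dots> = refl_product (map a us) (\<omega> i - a i)"
    using i by (simp add: refl_product_fweight[OF i vs] refl_root_norm_two fweight_inner)
  also have "\<dots> = \<omega> i - refl_product (map a us) (a i)"
    by (simp add: linear_diff[OF linear_refl_product] refl_product_fweight[OF i us])
  finally show ?thesis by (simp add: slice_root_def)
qed

text \<open>Peel off the last reflection of the prefix: a neighbour \<open>x\<close> of
  \<open>i\<close> contributes \<open>a x\<close> transported by the factors before
  \<open>x\<close>, which is its own slice root.\<close>

lemma refl_product_simple_root:
  assumes "factorization I a C (us @ vs)" "i \<in> I" "i \<notin> set us"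
  shows "refl_product (map a us) (a i) = a i + (\<Sum>j\<in>set us \<inter> nb i. slice_root I a C j)"
  using assms(1,3)
proof (induction us arbitrary: vs rule: rev_induct)
  case (snoc x us)
  have fac: "factorization I a C (us @ x # vs)" using snoc.prems by simp
  have x: "x \<in> I" "x \<noteq> i" "x \<notin> set us" using fac snoc.prems by (auto simp: factorization_def)
  have ax: "a i \<bullet> a x = (if x \<in> nb i then -1 else 0)"
    using x assms(2) by (simp add: simple_inner_cases)
  have "refl_product (map a (us @ [x])) (a i) = refl_product (map a us) (a i - (a i \<bullet> a x) *\<^sub>R a x)"
    using x by (simp add: refl_product_append refl_root_norm_two)
  also have "\<dots> = refl_product (map a us) (a i) - (a i \<bullet> a x) *\<^sub>R slice_root I a C x"
    by (simp add: linear_diff[OF linear_refl_product] linear_cmul[OF linear_refl_product]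
        slice_root_eq_refl_product[OF fac])
  also have "\<dots> = a i + (\<Sum>j\<in>set us \<inter> nb i. slice_root I a C j) - (a i \<bullet> a x) *\<^sub>R slice_root I a C x"
    using snoc.IH[OF fac] snoc.prems by simp
  also have "\<dots> = a i + (\<Sum>j\<in>set (us @ [x]) \<inter> nb i. slice_root I a C j)"
    using x by (auto simp: ax Int_insert_left)
  finally show ?case .
qed simp

lemma slice_root_recursion:
  assumes "factorization I a C xs" "i \<in> I"
  shows "slice_root I a C i = a i + (\<Sum>j\<in>{j\<in>nb i. precedes xs j i}. slice_root I a C j)"
proof -
  obtain us vs where xs: "xs = us @ i # vs"
    using assms by (blast dest: factorization_split)
  have d: "distinct (us @ i # vs)" using assms xs by (simp add: factorization_def)
  then have "{j\<in>nb i. precedes xs j i} = set us \<inter> nb i"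
    using precedes_iff[OF d] xs by auto
  moreover have "refl_product (map a us) (a i) = a i + (\<Sum>j\<in>set us \<inter> nb i. slice_root I a C j)"
    using refl_product_simple_root[of C us "i # vs" i] assms xs d by simp
  ultimately show ?thesis using slice_root_eq_refl_product[of C us i vs] assms(1) xs by simp
qed

text \<open>Apply 1 - \<open>C\<close> to the expansion of \<open>a i\<close> in fundamental
  weights, whose coefficients form a row of the Cartan matrix.\<close>

lemma simple_root_diff:
  assumes "linear C" "i \<in> I"
  shows "a i - C (a i) = 2 *\<^sub>R slice_root I a C i - (\<Sum>j\<in>nb i. slice_root I a C j)"
proof -
  have "a i - C (a i) = (\<Sum>j\<in>I. (a i \<bullet> a j) *\<^sub>R \<omega> j) - C (\<Sum>j\<in>I. (a i \<bullet> a j) *\<^sub>R \<omega> j)"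
    using fweight_expansion[of "a i"] by simp
  also have "\<dots> = (\<Sum>j\<in>I. (a i \<bullet> a j) *\<^sub>R slice_root I a C j)"
    by (simp add: linear_sum[OF assms(1)] linear_cmul[OF assms(1)] slice_root_def
        scaleR_diff_right sum_subtractf)
  finally show ?thesis by (simp add: cartan_sum assms)
qed

text \<open>Factors are added from the inside outwards. A new \<open>x\<close> lies outside the
  support of the root \<open>y\<close> built so far, so \<open>y \<bullet> a x\<close> is minus a
  sum of non-negative coordinates, hence 0 or -1, and the reflection changes the coordinate at
  \<open>x\<close> from 0 to 0 or 1.\<close>

lemma refl_product_coords:
  assumes "distinct xs" "set xs \<subseteq> I" "i \<in> I" "i \<notin> set xs"
  shows "refl_product (map a xs) (a i) \<in> R \<and>
    (\<forall>j\<in>I. \<omega> j \<bullet> refl_product (map a xs) (a i) \<in> {0, 1}) \<and>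
    (\<forall>j\<in>I - insert i (set xs). \<omega> j \<bullet> refl_product (map a xs) (a i) = 0)"
  using assms
proof (induction xs)
  case Nil
  then show ?case by (auto simp: a_in_R fweight_inner)
next
  case (Cons x xs)
  define y where "y = refl_product (map a xs) (a i)"
  have x: "x \<in> I" "x \<noteq> i" "x \<notin> set xs" using Cons.prems by auto
  have y: "y \<in> R" "\<And>j. j \<in> I \<Longrightarrow> \<omega> j \<bullet> y \<in> {0, 1}"
      "\<And>j. j \<in> I - insert i (set xs) \<Longrightarrow> \<omega> j \<bullet> y = 0"
    using Cons.IH Cons.prems by (auto simp: y_def)
  have eq: "refl_product (map a (x # xs)) (a i) = y - (y \<bullet> a x) *\<^sub>R a x"
    using x by (simp add: y_def refl_root_norm_two)
  have yx: "\<omega> x \<bullet> y = 0" using x y(3) by blast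
  then have "y \<noteq> a x" "y \<noteq> - a x" using x by (auto simp: fweight_inner)
  moreover have "y \<bullet> a x \<le> 0"
  proof -
    have "(\<Sum>j\<in>nb x. \<omega> j \<bullet> y) \<ge> 0"
      using y(2) nb_subset by (intro sum_nonneg) force
    then show ?thesis using inner_simple[OF x(1), of y] yx by simp
  qed
  ultimately have "y \<bullet> a x \<in> {-1, 0}"
    using root_inner_bound[of y "a x"] y(1) a_in_R[OF x(1)] by auto
  then have "\<omega> j \<bullet> (y - (y \<bullet> a x) *\<^sub>R a x) \<in> {0, 1}" if "j \<in> I" for j
    using y(2)[OF that] that x yx by (auto simp: inner_diff_right fweight_inner split: if_splits)
  moreover have "\<omega> j \<bullet> (y - (y \<bullet> a x) *\<^sub>R a x) = 0" if "j \<in> I - insert i (set (x # xs))" for j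
    using that x y(3)[of j] by (auto simp: inner_diff_right fweight_inner)
  moreover have "y - (y \<bullet> a x) *\<^sub>R a x \<in> R"
    using refl_in_R[OF a_in_R[OF x(1)] y(1)] x by (simp add: refl_root_norm_two)
  ultimately show ?case unfolding eq by blast
qed

lemma slice_root_coords:
  assumes "factorization I a C (us @ i # vs)"
  shows "slice_root I a C i \<in> R"
    and "j \<in> I \<Longrightarrow> \<omega> j \<bullet> slice_root I a C i \<in> {0, 1}"
    and "j \<in> I \<Longrightarrow> j \<noteq> i \<Longrightarrow> j \<notin> set us \<Longrightarrow> \<omega> j \<bullet> slice_root I a C i = 0"
  using refl_product_coords[of us i] assms
  unfolding slice_root_eq_refl_product[OF assms] by (auto simp: factorization_def)

text \<open>The recursion adds non-negative terms, so nothing cancels: coordinate \<open>k\<close>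
  of the slice root at \<open>i\<close> is non-zero iff \<open>k = i\<close> or it is non-zero for a
  neighbour preceding \<open>i\<close>. All coordinates being 0 or 1, this identifies the slice root
  with the sum that defines \<open>beta\<close>.\<close>

lemma slice_root_support:
  assumes "factorization I a C xs" "i \<in> I" "k \<in> I"
  shows "\<omega> k \<bullet> slice_root I a C i = (if (\<lambda>j i. i \<in> I \<and> j \<in> nb i \<and> precedes xs j i)\<^sup>*\<^sup>* k i then 1 else 0)"
    (is "_ = (if ?r\<^sup>*\<^sup>* k i then 1 else 0)")
proof -
  let ?b = "slice_root I a C"
  have val: "\<omega> k \<bullet> ?b j \<in> {0, 1}" if "j \<in> I" for j
  proof -
    obtain us vs where "xs = us @ j # vs" using \<open>j \<in> I\<close> assms(1) by (blast dest: factorization_split)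
    then show ?thesis using slice_root_coords(2)[of C us j vs k] assms(1,3) by simp
  qed
  have main: "\<omega> k \<bullet> ?b i \<noteq> 0 \<longleftrightarrow> ?r\<^sup>*\<^sup>* k i" if "xs = us @ i # vs" "i \<in> I" for us vs i
    using that
  proof (induction "length us" arbitrary: us i vs rule: less_induct)
    case less
    have d: "distinct (us @ i # vs)" using assms less.prems by (simp add: factorization_def)
    have IH: "\<omega> k \<bullet> ?b j \<noteq> 0 \<longleftrightarrow> ?r\<^sup>*\<^sup>* k j" if r: "?r j i" for j
    proof -
      have "j \<in> set us" using r precedes_iff[OF d] less.prems by simp
      then obtain us1 us2 where "us = us1 @ j # us2" by (meson split_list)
      moreover from this have "xs = us1 @ j # (us2 @ i # vs)" using less.prems by simp
      moreover have "j \<in> I" using r nb_subset[of i] by blast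
      ultimately show ?thesis using less.hyps[of us1 j "us2 @ i # vs"] by simp
    qed
    let ?N = "{j\<in>nb i. precedes xs j i}"
    have N: "finite ?N" "\<And>j. j \<in> ?N \<Longrightarrow> \<omega> k \<bullet> ?b j \<ge> 0"
    proof -
      show "finite ?N" using finite_nb[of i] by simp
      show "\<omega> k \<bullet> ?b j \<ge> 0" if "j \<in> ?N" for j
      proof -
        have "j \<in> I" using that nb_subset[of i] by blast
        then show ?thesis using val[of j] by auto
      qed
    qed
    have eq: "\<omega> k \<bullet> ?b i = (if i = k then 1 else 0) + (\<Sum>j\<in>?N. \<omega> k \<bullet> ?b j)"
      by (subst slice_root_recursion[OF assms(1) less.prems(2)])
        (simp only: inner_add_right inner_sum_right fweight_inner[OF assms(3) less.prems(2)])
    have sum: "(\<Sum>j\<in>?N. \<omega> k \<bullet> ?b j) \<ge> 0"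
        "(\<Sum>j\<in>?N. \<omega> k \<bullet> ?b j) = 0 \<longleftrightarrow> (\<forall>j\<in>?N. \<omega> k \<bullet> ?b j = 0)"
      using sum_nonneg[of ?N "\<lambda>j. \<omega> k \<bullet> ?b j"] sum_nonneg_eq_0_iff[of ?N "\<lambda>j. \<omega> k \<bullet> ?b j"] N by blast+
    have arith: "(if i = k then 1 else 0) + S \<noteq> 0 \<longleftrightarrow> i = k \<or> S \<noteq> 0" if "0 \<le> S" for S :: real
      using that by auto
    have "\<omega> k \<bullet> ?b i \<noteq> 0 \<longleftrightarrow> i = k \<or> \<not> (\<forall>j\<in>?N. \<omega> k \<bullet> ?b j = 0)"
      unfolding eq sum(2)[symmetric] by (rule arith[OF sum(1)])
    also have "\<dots> \<longleftrightarrow> i = k \<or> (\<exists>j. ?r j i \<and> \<omega> k \<bullet> ?b j \<noteq> 0)"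
      using less.prems(2) by blast
    also have "\<dots> \<longleftrightarrow> i = k \<or> (\<exists>j. ?r j i \<and> ?r\<^sup>*\<^sup>* k j)" using IH by blast
    also have "\<dots> \<longleftrightarrow> ?r\<^sup>*\<^sup>* k i"
      by (blast elim: rtranclp.cases intro: rtranclp.intros)
    finally show ?case .
  qed
  obtain us vs where "xs = us @ i # vs" using assms by (blast dest: factorization_split)
  then show ?thesis using main[OF _ assms(2), of us vs] val[OF assms(2)] by (simp split: if_split) blast
qed

text \<open>For neighbours \<open>j\<close> and \<open>i\<close>, the order is read off from a coordinate of \<open>\<beta>\<^sub>i\<close>, which depends only on
  \<open>C\<close>.\<close>
lemma precedes_independent:
  assumes "factorization I a C xs" "factorization I a C ys" "i \<in> I" "j \<in> nb i" "precedes xs j i"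
  shows "precedes ys j i"
proof (rule ccontr)
  assume n: "\<not> precedes ys j i"
  obtain us vs where ys: "ys = us @ i # vs" using assms by (blast dest: factorization_split)
  have d: "distinct (us @ i # vs)" using assms ys by (simp add: factorization_def)
  have j: "j \<in> I" "j \<noteq> i" using assms nb_subset nb_irrefl by auto
  have "j \<notin> set us" using n precedes_iff[OF d] ys by simp
  then have "\<omega> j \<bullet> slice_root I a C i = 0"
    using slice_root_coords(3)[of C us i vs j] assms(2) ys j by simp
  moreover have "(\<lambda>j i. i \<in> I \<and> j \<in> nb i \<and> precedes xs j i)\<^sup>*\<^sup>* j i"
    using assms(3-5) by (intro r_into_rtranclp) simp
  ultimately show False
    using slice_root_support[OF assms(1,3) j(1)] by simp
qed

section \<open>The diagram\<close>

text \<open>Otherwise the sum \<open>x\<close> of the simple roots in \<open>J\<close> has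
  non-positive inner product with each of them, so \<open>x \<bullet> x \<le> 0\<close>, against
  positive definiteness.\<close>

lemma exists_leaf:
  assumes "J \<subseteq> I" "J \<noteq> {}"
  shows "\<exists>i\<in>J. card (nb i \<inter> J) \<le> 1"
proof (rule ccontr)
  assume "\<not> ?thesis"
  then have deg: "2 \<le> real (card (nb i \<inter> J))" if "i \<in> J" for i using that by force
  define x where "x = (\<Sum>i\<in>J. a i)"
  have J: "finite J" using assms finite_I finite_subset by blast
  have coord: "\<omega> i \<bullet> x = (if i \<in> J then 1 else 0)" if "i \<in> I" for i
  proof -
    have "\<omega> i \<bullet> x = (\<Sum>j\<in>J. if j = i then 1 else 0)"
      unfolding x_def inner_sum_right using assms that by (intro sum.cong) (auto simp: fweight_inner)
    then show ?thesis using J by simp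
  qed
  have "x \<bullet> a i = 2 - real (card (nb i \<inter> J))" if "i \<in> J" for i
  proof -
    have "(\<Sum>j\<in>nb i. \<omega> j \<bullet> x) = (\<Sum>j\<in>nb i. if j \<in> J then 1 else 0)"
      by (intro sum.cong) (use nb_subset[of i] in \<open>auto simp: coord subset_iff\<close>)
    also have "\<dots> = real (card (nb i \<inter> J))"
      using finite_nb by (simp add: sum.If_cases)
    finally show ?thesis using inner_simple[of i x] coord[of i] that assms by auto
  qed
  then have "x \<bullet> x \<le> 0"
    using deg by (subst (2) x_def) (auto simp: inner_sum_right intro!: sum_nonpos)
  moreover have "x \<noteq> 0" using coord assms by (metis (no_types, lifting) ex_in_conv inner_zero_right subsetD zero_neq_one)
  ultimately show False using inner_gt_zero_iff[of x] by linarith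
qed

text \<open>The diagram is a forest, so heights can be assigned by removing one leaf after another.\<close>
lemma exists_height:
  assumes "\<And>i j. r i j \<Longrightarrow> \<not> r j i" "J \<subseteq> I"
  shows "\<exists>s::'i \<Rightarrow> int. \<forall>i\<in>J. \<forall>j\<in>J. j \<in> nb i \<and> r i j \<longrightarrow> s j = s i + 1"
  using assms(2)
proof (induction "card J" arbitrary: J)
  case 0
  then have "J = {}" using finite_I finite_subset by (metis card_eq_0_iff)
  then show ?case by simp
next
  case (Suc n)
  have J: "finite J" using Suc.prems finite_I finite_subset by blast
  have "J \<noteq> {}" using Suc.hyps(2) by auto
  then obtain v where v: "v \<in> J" "card (nb v \<inter> J) \<le> 1" using exists_leaf Suc.prems by blast
  have "n = card (J - {v})" using Suc.hyps(2) v J by simp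
  then obtain s :: "'i \<Rightarrow> int" where
      s: "\<forall>i\<in>J - {v}. \<forall>j\<in>J - {v}. j \<in> nb i \<and> r i j \<longrightarrow> s j = s i + 1"
    using Suc.hyps(1)[of "J - {v}"] Suc.prems by blast
  have vI: "v \<in> I" using v Suc.prems by blast
  show ?case
  proof (cases "nb v \<inter> J = {}")
    case True
    then have "\<forall>i\<in>J. v \<notin> nb i" using nb_sym Suc.prems by blast
    with True s show ?thesis by (intro exI[of _ s]) auto
  next
    case False
    then have "card (nb v \<inter> J) = 1"
      using v(2) finite_nb[of v] by (metis One_nat_def card_0_eq finite_Int le_Suc_eq le_zero_eq)
    then obtain u where u: "nb v \<inter> J = {u}" by (rule card_1_singletonE)
    have uv: "u \<noteq> v" using u nb_irrefl[of v] by blast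
    have only: "i = u" if "i \<in> J" "v \<in> nb i" for i
      using that u nb_sym[of i v] Suc.prems by blast
    \<comment> \<open>The only edge at the leaf \<open>v\<close> dictates its height relative to
      \<open>u\<close>; if \<open>r\<close> relates the two in neither direction, any value would
      do.\<close>
    define t where "t = s(v := (if r v u then s u - 1 else s u + 1))"
    have "t j = t i + 1" if "i \<in> J" "j \<in> J" "j \<in> nb i" "r i j" for i j
    proof (cases "i = v")
      case True
      then have "j = u" using that u by blast
      with True that uv show ?thesis by (simp add: t_def)
    next
      case iv: False
      show ?thesis
      proof (cases "j = v")
        case True
        then have "i = u" using only that by blast
        then show ?thesis using True that uv assms(1)[of u v] by (simp add: t_def)
      next
        case False
        then show ?thesis using iv that s by (simp add: t_def)
      qed
    qed
    then show ?thesis by blast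
  qed
qed

text \<open>The root lattice is even. This prevents a root, of square length 2, from splitting into
  two non-zero orthogonal lattice vectors.\<close>

lemma even_norm:
  assumes "finite J" "J \<subseteq> I" "\<And>i. i \<in> J \<Longrightarrow> c i \<in> \<int>"
  shows "\<exists>m::int. (\<Sum>i\<in>J. c i *\<^sub>R a i) \<bullet> (\<Sum>i\<in>J. c i *\<^sub>R a i) = 2 * of_int m"
  using assms
proof (induction J rule: finite_induct)
  case empty
  show ?case by (intro exI[of _ 0]) simp
next
  case (insert k J)
  let ?x = "\<Sum>i\<in>J. c i *\<^sub>R a i"
  obtain m :: int where m: "?x \<bullet> ?x = 2 * of_int m" using insert by auto
  have "?x \<bullet> a k \<in> \<int>"
    unfolding inner_sum_left
  proof (rule Ints_sum)
    fix i assume "i \<in> J"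
    then have "c i \<in> \<int>" "a i \<bullet> a k \<in> \<int>" using insert.prems inner_Ints a_in_R by auto
    then show "c i *\<^sub>R a i \<bullet> a k \<in> \<int>" by simp
  qed
  moreover have "c k \<in> \<int>" using insert.prems by simp
  ultimately obtain p q :: int where pq: "?x \<bullet> a k = of_int p" "c k = of_int q"
    by (metis Ints_cases)
  have "(\<Sum>i\<in>insert k J. c i *\<^sub>R a i) \<bullet> (\<Sum>i\<in>insert k J. c i *\<^sub>R a i)
      = (?x + c k *\<^sub>R a k) \<bullet> (?x + c k *\<^sub>R a k)"
    using insert by (simp add: add.commute)
  also have "\<dots> = ?x \<bullet> ?x + 2 * c k * (?x \<bullet> a k) + c k * c k * (a k \<bullet> a k)"
    unfolding inner_add_left inner_add_right inner_scaleR_left inner_scaleR_right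
    by (simp only: inner_commute[of "a k" ?x]) (simp add: algebra_simps)
  also have "\<dots> = ?x \<bullet> ?x + 2 * c k * (?x \<bullet> a k) + c k * c k * 2"
    using insert.prems by simp
  also have "\<dots> = 2 * of_int (m + q * p + q * q)" unfolding m pq by simp
  finally show ?case by blast
qed

text \<open>A proper non-empty subset closed under neighbours would split the space orthogonally.
  The two components of a root have even square lengths adding up to 2, so one component vanishes,
  and the roots fall into two orthogonal classes.\<close>

lemma diagram_connected:
  assumes "irreducible_rs R" "J \<subseteq> I" "J \<noteq> {}" "\<And>i. i \<in> J \<Longrightarrow> nb i \<subseteq> J"
  shows "J = I"
proof (rule ccontr)
  assume ne: "J \<noteq> I"
  define K where "K = I - J"
  have KJ: "K \<subseteq> I" "K \<noteq> {}" "I = J \<union> K" "J \<inter> K = {}" using ne assms by (auto simp: K_def)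
  have fin: "finite J" "finite K" using KJ finite_I assms(2) finite_subset by blast+
  have orth: "a i \<bullet> a k = 0" if "i \<in> J" "k \<in> K" for i k
  proof -
    have "i \<in> I" "k \<in> I" "k \<notin> nb i" "i \<noteq> k" using that assms KJ by blast+
    then show ?thesis by (simp add: simple_inner_cases)
  qed
  define xJ where "xJ y = (\<Sum>i\<in>J. (\<omega> i \<bullet> y) *\<^sub>R a i)" for y
  define xK where "xK y = (\<Sum>i\<in>K. (\<omega> i \<bullet> y) *\<^sub>R a i)" for y
  have split: "y = xJ y + xK y" for y
    unfolding xJ_def xK_def
    by (subst sum.union_disjoint[symmetric]) (use fin KJ coord_expansion[of y] in auto)
  have xJK: "xJ y \<bullet> xK z = 0" for y z
    unfolding xJ_def xK_def inner_sum_left inner_sum_right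
    by (intro sum.neutral ballI) (simp add: orth)
  define A where "A = {y\<in>R. xK y = 0}"
  define B where "B = {y\<in>R. xJ y = 0}"
  have delta: "\<omega> i \<bullet> a k = 0" if "i \<in> I" "k \<in> I" "i \<noteq> k" for i k
    using that by (simp add: fweight_inner)
  have "a i \<in> A" if i: "i \<in> J" for i
  proof -
    have "\<omega> k \<bullet> a i = 0" if "k \<in> K" for k
      using that i KJ assms(2) by (intro delta) blast+
    then show ?thesis using i a_in_R assms(2) by (auto simp: A_def xK_def)
  qed
  then have "A \<noteq> {}" using assms by blast
  moreover have "a i \<in> B" if i: "i \<in> K" for i
  proof -
    have "\<omega> k \<bullet> a i = 0" if "k \<in> J" for k
      using that i KJ assms(2) by (intro delta) blast+
    then show ?thesis using i a_in_R KJ(1) by (auto simp: B_def xJ_def)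
  qed
  then have "B \<noteq> {}" using KJ by blast
  moreover have "A \<inter> B = {}"
  proof -
    have "y = 0" if "y \<in> A \<inter> B" for y using split[of y] that by (simp add: A_def B_def)
    moreover have "0 \<notin> R" using root_system by (simp add: root_system_def)
    ultimately show ?thesis by (auto simp: A_def)
  qed
  moreover have "\<forall>y\<in>A. \<forall>z\<in>B. y \<bullet> z = 0"
    using split xJK by (metis (mono_tags, lifting) A_def B_def add.right_neutral add_0 mem_Collect_eq)
  moreover have "A \<union> B = R"
  proof -
    have "y \<in> A \<union> B" if y: "y \<in> R" for y
    proof -
      have ints: "\<omega> i \<bullet> y \<in> \<int>" if "i \<in> I" for i using root_coords(1)[OF y, of i] that by blast
      obtain m n :: int where mn: "xJ y \<bullet> xJ y = 2 * of_int m" "xK y \<bullet> xK y = 2 * of_int n"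
        using even_norm[OF fin(1) assms(2), of "\<lambda>i. \<omega> i \<bullet> y"]
          even_norm[OF fin(2) KJ(1), of "\<lambda>i. \<omega> i \<bullet> y"] ints KJ assms(2)
        unfolding xJ_def xK_def by blast
      have "y \<bullet> y = xJ y \<bullet> xJ y + xK y \<bullet> xK y"
        using xJK by (subst (1 2) split) (simp add: inner_add_left inner_add_right inner_commute[of "xK y" "xJ y"])
      then have "2 = 2 * (of_int (m + n) :: real)" using mn norm_two[OF y] by simp
      then have "(of_int (m + n) :: real) = of_int 1" by simp
      then have "m + n = 1" by (simp only: of_int_eq_iff)
      moreover have "m \<ge> 0" "n \<ge> 0"
        using inner_ge_zero[of "xJ y"] inner_ge_zero[of "xK y"] mn by auto
      ultimately have "m = 0 \<or> n = 0" by linarith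
      then show ?thesis using mn y by (auto simp: A_def B_def)
    qed
    then show ?thesis by (auto simp: A_def B_def)
  qed
  ultimately show False using assms(1) unfolding irreducible_rs_def by blast
qed

section \<open>Perron-Frobenius theory of the adjacency matrix\<close>

lemma sum_nb_swap:
  fixes F :: "'i \<Rightarrow> 'i \<Rightarrow> real"
  shows "(\<Sum>i\<in>I. \<Sum>j\<in>nb i. F i j) = (\<Sum>j\<in>I. \<Sum>i\<in>nb j. F i j)"
proof -
  have "nb i = {j\<in>I. a i \<bullet> a j = -1}" "nb i = {j\<in>I. a j \<bullet> a i = -1}" for i
    by (auto simp: nbrs_def inner_commute)
  then show ?thesis using sum.swap_restrict[OF finite_I finite_I, of F "\<lambda>i j. a i \<bullet> a j = -1"] by simp
qed

text \<open>Pair the absolute values of \<open>u\<close> with \<open>g\<close>. By symmetry of the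
  adjacency matrix \<open>A\<close>, \<open>\<nu> (g, |u|) \<le> (g, A |u|) = (A g, |u|) = \<mu> (g,
  |u|)\<close>, and the pairing is positive.\<close>

lemma perron_maximal:
  fixes u g :: "'i \<Rightarrow> real"
  assumes "\<And>i. i \<in> I \<Longrightarrow> g i > 0" "\<And>i. i \<in> I \<Longrightarrow> \<mu> * g i = (\<Sum>j\<in>nb i. g j)"
    and "\<And>i. i \<in> I \<Longrightarrow> \<nu> * u i = (\<Sum>j\<in>nb i. u j)" "k \<in> I" "u k \<noteq> 0"
  shows "\<nu> \<le> \<mu>"
proof -
  define T where "T = (\<Sum>i\<in>I. g i * \<bar>u i\<bar>)"
  have "T > 0"
    unfolding T_def
  proof (rule sum_pos2[OF finite_I \<open>k \<in> I\<close>])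
    show "0 < g k * \<bar>u k\<bar>" using assms by simp
    show "0 \<le> g i * \<bar>u i\<bar>" if "i \<in> I" for i using assms(1)[OF that] by simp
  qed
  have "\<nu> * T \<le> (\<Sum>i\<in>I. \<Sum>j\<in>nb i. g i * \<bar>u j\<bar>)"
    unfolding T_def sum_distrib_left
  proof (rule sum_mono)
    fix i assume i: "i \<in> I"
    have "\<nu> * \<bar>u i\<bar> \<le> \<bar>\<nu> * u i\<bar>" by (simp add: abs_mult mult_right_mono)
    also have "\<dots> \<le> (\<Sum>j\<in>nb i. \<bar>u j\<bar>)" using assms(3)[OF i] by simp
    finally have "g i * (\<nu> * \<bar>u i\<bar>) \<le> g i * (\<Sum>j\<in>nb i. \<bar>u j\<bar>)"
      using assms(1)[OF i] by (simp add: mult_left_mono)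
    then show "\<nu> * (g i * \<bar>u i\<bar>) \<le> (\<Sum>j\<in>nb i. g i * \<bar>u j\<bar>)"
      by (simp add: sum_distrib_left algebra_simps)
  qed
  also have "\<dots> = (\<Sum>j\<in>I. \<Sum>i\<in>nb j. g i * \<bar>u j\<bar>)" by (rule sum_nb_swap)
  also have "\<dots> = \<mu> * T"
    unfolding T_def sum_distrib_left
    by (intro sum.cong) (auto simp: sum_distrib_right[symmetric] assms(2)[symmetric])
  finally show ?thesis using \<open>T > 0\<close> by simp
qed

text \<open>Take the largest ratio \<open>c\<close> of \<open>u\<close> to \<open>g\<close>. Then
  \<open>c * g - u\<close> is non-negative, has a zero and satisfies the same eigenvalue equation; a
  zero forces zeros at all neighbours, and the diagram is connected.\<close>

lemma perron_unique:
  fixes u g :: "'i \<Rightarrow> real"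
  assumes "irreducible_rs R" "\<And>i. i \<in> I \<Longrightarrow> g i > 0"
    and "\<And>i. i \<in> I \<Longrightarrow> \<mu> * g i = (\<Sum>j\<in>nb i. g j)" "\<And>i. i \<in> I \<Longrightarrow> \<mu> * u i = (\<Sum>j\<in>nb i. u j)"
  shows "\<exists>c. \<forall>i\<in>I. u i = c * g i"
proof (cases "I = {}")
  case False
  define c where "c = Max ((\<lambda>i. u i / g i) ` I)"
  have le: "u i \<le> c * g i" if "i \<in> I" for i
  proof -
    have "u i / g i \<le> c" unfolding c_def using that finite_I by (intro Max_ge) auto
    then show ?thesis using assms(2)[OF that] by (simp add: field_simps)
  qed
  define J where "J = {i\<in>I. u i = c * g i}"
  have "c \<in> (\<lambda>i. u i / g i) ` I" unfolding c_def using False finite_I by (intro Max_in) auto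
  then have "J \<noteq> {}" unfolding J_def using assms(2) by force
  moreover have "nb i \<subseteq> J" if "i \<in> J" for i
  proof -
    have i: "i \<in> I" "u i = c * g i" using that by (auto simp: J_def)
    have "(\<Sum>j\<in>nb i. c * g j - u j) = c * (\<mu> * g i) - \<mu> * u i"
      using assms(3,4)[OF i(1)] by (simp add: sum_subtractf sum_distrib_left)
    then have "(\<Sum>j\<in>nb i. c * g j - u j) = 0" using i by simp
    moreover have "\<And>j. j \<in> nb i \<Longrightarrow> 0 \<le> c * g j - u j" using le nb_subset[of i] by force
    ultimately have "\<forall>j\<in>nb i. c * g j - u j = 0"
      using sum_nonneg_eq_0_iff[OF finite_nb[of i], of "\<lambda>j. c * g j - u j"] by blast
    then show ?thesis using nb_subset[of i] by (auto simp: J_def)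
  qed
  ultimately have "J = I" using diagram_connected[OF assms(1), of J] by (auto simp: J_def)
  then show ?thesis by (auto simp: J_def)
qed simp

text \<open>The Perron eigenvector comes from maximizing the sum of squared coordinates on the unit sphere:
  passing to absolute values of the coordinates does not increase the norm, so a maximizer can be
  taken non-negative.\<close>
lemma perron_exists:
  assumes irr: "irreducible_rs R"
  shows "\<exists>(\<mu>::real) g. 0 \<le> \<mu> \<and> \<mu> < 2 \<and> (\<forall>i\<in>I. 0 < g i) \<and> (\<forall>i\<in>I. \<mu> * g i = (\<Sum>j\<in>nb i. g j))"
proof -
  define S where "S x = (\<Sum>i\<in>I. (\<omega> i \<bullet> x)\<^sup>2)" for x
  define B where "B x y = (\<Sum>i\<in>I. (\<omega> i \<bullet> x) * (\<omega> i \<bullet> y))" for x y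
  have S_scale: "S (t *\<^sub>R x) = t\<^sup>2 * S x" for t x
    by (simp add: S_def power_mult_distrib sum_distrib_left)
  have S_add: "S (x + t *\<^sub>R y) = S x + 2 * t * B x y + t\<^sup>2 * S y" for x y t
  proof -
    have "(p + t * q)\<^sup>2 = p\<^sup>2 + 2 * t * (p * q) + t\<^sup>2 * q\<^sup>2" for p q :: real
      by (simp add: power2_eq_square algebra_simps)
    then show ?thesis
      by (simp add: S_def B_def inner_add_right sum.distrib sum_distrib_left)
  qed
  have "R \<noteq> {}" "0 \<notin> R" using irr root_system by (auto simp: irreducible_rs_def root_system_def)
  then obtain y where y: "y \<in> R" "y \<noteq> 0" by force
  then have "(1 / norm y) *\<^sub>R y \<in> sphere 0 1" by simp
  then have "sphere (0::'a) 1 \<noteq> {}" by blast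
  moreover have "continuous_on (sphere 0 1) S"
    unfolding S_def by (intro continuous_intros)
  ultimately obtain x where x: "x \<in> sphere 0 1" "\<forall>y\<in>sphere 0 1. S y \<le> S x"
    using continuous_attains_sup[of "sphere 0 1" S] compact_sphere by blast
  have xx: "x \<bullet> x = 1" using x by (simp add: norm_eq_1)
  have S_le: "S y \<le> S x * (y \<bullet> y)" for y
  proof (cases "y = 0")
    case False
    have "S ((1 / norm y) *\<^sub>R y) \<le> S x" using x False by simp
    then have "S y \<le> S x * (norm y)\<^sup>2"
      unfolding S_scale using False by (simp add: power_divide field_simps)
    then show ?thesis by (simp add: power2_norm_eq_inner)
  qed (simp add: S_def)
  define g where "g i = \<bar>\<omega> i \<bullet> x\<bar>" for i
  define z where "z = (\<Sum>i\<in>I. g i *\<^sub>R a i)"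
  have z: "\<omega> i \<bullet> z = g i" if "i \<in> I" for i unfolding z_def by (rule coord_sum[OF that])
  have Sz: "S z = S x" unfolding S_def by (intro sum.cong) (auto simp: z g_def)
  have quad: "y \<bullet> y = (\<Sum>i\<in>I. (\<omega> i \<bullet> y) * (2 * (\<omega> i \<bullet> y) - (\<Sum>j\<in>nb i. \<omega> j \<bullet> y)))" for y
  proof -
    have "y \<bullet> y = y \<bullet> (\<Sum>i\<in>I. (\<omega> i \<bullet> y) *\<^sub>R a i)" using coord_expansion[of y] by simp
    then show ?thesis by (simp add: inner_sum_right inner_simple)
  qed
  have "S x \<noteq> 0"
  proof
    assume "S x = 0"
    then have "\<omega> i \<bullet> x = 0" if "i \<in> I" for i
      using that finite_I unfolding S_def by (simp add: sum_nonneg_eq_0_iff)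
    then have "x = 0" using coord_expansion[of x] by simp
    then show False using xx by simp
  qed
  moreover have "S x \<ge> 0" unfolding S_def by (intro sum_nonneg) simp
  ultimately have Spos: "S x > 0" by simp
  have "z \<bullet> z \<le> x \<bullet> x"
    unfolding quad[of z] quad[of x]
  proof (rule sum_mono)
    fix i assume i: "i \<in> I"
    have "(\<Sum>j\<in>nb i. \<omega> j \<bullet> z) = (\<Sum>j\<in>nb i. g j)"
      by (intro sum.cong) (use z nb_subset[of i] in auto)
    moreover have "(\<omega> i \<bullet> x) * (\<Sum>j\<in>nb i. \<omega> j \<bullet> x) \<le> g i * (\<Sum>j\<in>nb i. g j)"
    proof -
      have "(\<omega> i \<bullet> x) * (\<Sum>j\<in>nb i. \<omega> j \<bullet> x) \<le> \<bar>\<omega> i \<bullet> x\<bar> * \<bar>\<Sum>j\<in>nb i. \<omega> j \<bullet> x\<bar>"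
        by (metis abs_ge_self abs_mult)
      also have "\<dots> \<le> g i * (\<Sum>j\<in>nb i. g j)"
        unfolding g_def by (intro mult_left_mono) auto
      finally show ?thesis .
    qed
    moreover have "g i * g i = (\<omega> i \<bullet> x) * (\<omega> i \<bullet> x)" by (simp add: g_def)
    ultimately show "(\<omega> i \<bullet> z) * (2 * (\<omega> i \<bullet> z) - (\<Sum>j\<in>nb i. \<omega> j \<bullet> z))
        \<le> (\<omega> i \<bullet> x) * (2 * (\<omega> i \<bullet> x) - (\<Sum>j\<in>nb i. \<omega> j \<bullet> x))"
      using i by (simp add: z right_diff_distrib)
  qed
  moreover have "1 \<le> z \<bullet> z" using S_le[of z] Spos Sz by simp
  ultimately have zz: "z \<bullet> z = 1" using xx by simp
  \<comment> \<open>The form \<open>S x * (y \<bullet> y) - S y\<close> is non-negative in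
    \<open>y\<close> and vanishes at \<open>z\<close>, so its first variation at \<open>z\<close> is
    zero.\<close>
  have stationary: "B z y = S x * (z \<bullet> y)" for y
  proof -
    have "2 * (S x * (z \<bullet> y) - B z y) = 0"
    proof (rule linear_coeff_zero)
      fix t :: real
      have "S x + 2 * t * B z y + t\<^sup>2 * S y \<le> S x * ((z + t *\<^sub>R y) \<bullet> (z + t *\<^sub>R y))"
        using S_le[of "z + t *\<^sub>R y"] by (simp add: S_add Sz)
      also have "(z + t *\<^sub>R y) \<bullet> (z + t *\<^sub>R y) = 1 + 2 * t * (z \<bullet> y) + t\<^sup>2 * (y \<bullet> y)"
        using zz by (simp add: inner_add_left inner_add_right inner_commute[of y z] power2_eq_square algebra_simps)
      finally show "0 \<le> t * (2 * (S x * (z \<bullet> y) - B z y)) + t\<^sup>2 * (S x * (y \<bullet> y) - S y)"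
        by (simp add: algebra_simps)
    qed
    then show ?thesis by simp
  qed
  \<comment> \<open>Stationarity tested on \<open>a i\<close> reads
    \<open>g i = S x * (2 * g i - N)\<close> with \<open>N\<close> the sum of \<open>g\<close> over
    the neighbours; solving for \<open>N\<close> gives this eigenvalue.\<close>
  define \<mu> where "\<mu> = 2 - 1 / S x"
  have eig: "\<mu> * g i = (\<Sum>j\<in>nb i. g j)" if i: "i \<in> I" for i
  proof -
    have "B z (a i) = (\<Sum>k\<in>I. g k * (if i = k then 1 else 0))"
      unfolding B_def by (intro sum.cong) (auto simp: z fweight_inner i)
    then have "B z (a i) = g i" using i finite_I by (simp add: if_distrib cong: if_cong)
    moreover have "(\<Sum>j\<in>nb i. \<omega> j \<bullet> z) = (\<Sum>j\<in>nb i. g j)"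
      by (intro sum.cong) (use z nb_subset[of i] in auto)
    ultimately have "g i = S x * (2 * g i - (\<Sum>j\<in>nb i. g j))"
      using stationary[of "a i"] inner_simple[OF i, of z] z[OF i] by simp
    then show ?thesis using Spos unfolding \<mu>_def by (simp add: field_simps)
  qed
  \<comment> \<open>As \<open>g\<close> is non-negative, a zero entry forces zeros at all
    neighbours, and by connectedness everywhere, against \<open>z \<bullet> z = 1\<close>.\<close>
  have pos: "g i > 0" if "i \<in> I" for i
  proof (rule ccontr)
    assume "\<not> g i > 0"
    then have "g i = 0" by (simp add: g_def)
    define J where "J = {i\<in>I. g i = 0}"
    have "nb j \<subseteq> J" if j: "j \<in> J" for j
    proof -
      have "(\<Sum>k\<in>nb j. g k) = 0" using eig[of j] j by (simp add: J_def)
      then have "\<forall>k\<in>nb j. g k = 0"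
        using sum_nonneg_eq_0_iff[OF finite_nb[of j], of g] by (simp add: g_def)
      then show ?thesis using nb_subset[of j] by (auto simp: J_def)
    qed
    moreover have "J \<subseteq> I" "J \<noteq> {}" using that \<open>g i = 0\<close> by (auto simp: J_def)
    ultimately have "J = I" using diagram_connected[OF irr] by blast
    then have "z = 0" unfolding z_def by (intro sum.neutral) (auto simp: J_def)
    then show False using zz by simp
  qed
  have "I \<noteq> {}" using coord_expansion[of x] xx by force
  then obtain i where i: "i \<in> I" by blast
  have "0 \<le> \<mu> * g i" unfolding eig[OF i] by (intro sum_nonneg) (simp add: g_def)
  then have "0 \<le> \<mu>" using pos[OF i] by (simp add: zero_le_mult_iff)
  moreover have "\<mu> < 2" using Spos by (simp add: \<mu>_def)
  ultimately show ?thesis using pos eig by blast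
qed

end

section \<open>The Coxeter plane\<close>

lemma simple_system_nonneg_coeffs:
  assumes "simple_system R P" "linear l" "\<And>x. x \<in> P \<Longrightarrow> l x > (0::real)" "x \<in> R" "l x > 0"
  obtains c :: "'a::euclidean_space \<Rightarrow> int"
  where "x = (\<Sum>y\<in>P. of_int (c y) *\<^sub>R y)" "\<And>y. y \<in> P \<Longrightarrow> c y \<ge> 0"
proof -
  obtain c :: "'a \<Rightarrow> int" where c: "x = (\<Sum>y\<in>P. of_int (c y) *\<^sub>R y)"
      "(\<forall>y\<in>P. c y \<ge> 0) \<or> (\<forall>y\<in>P. c y \<le> 0)"
    using assms(1,4) unfolding simple_system_def by blast
  have "\<not> (\<forall>y\<in>P. c y \<le> 0)"
  proof
    assume neg: "\<forall>y\<in>P. c y \<le> 0"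
    have "l x = (\<Sum>y\<in>P. of_int (c y) * l y)"
      using c(1) by (simp add: linear_sum[OF assms(2)] linear_cmul[OF assms(2)])
    also have "\<dots> \<le> 0"
    proof (rule sum_nonpos)
      fix y assume y: "y \<in> P"
      have "of_int (c y) \<le> (0::real)" using neg y by simp
      then show "of_int (c y) * l y \<le> 0" using assms(3)[OF y] by (simp add: mult_nonpos_nonneg)
    qed
    finally show False using assms(5) by simp
  qed
  then show ?thesis using c that by blast
qed

text \<open>Let \<open>h\<close> be the height with respect to \<open>P'\<close>: it is 1 on
  \<open>P'\<close> and, by integrality, at least 1 on \<open>P\<close>. An element of
  \<open>P'\<close> is a non-negative integral combination of \<open>P\<close> with
  \<open>h\<close>-value 1, which leaves room for a single term with coefficient 1.\<close>

lemma simple_system_subset: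
  assumes P: "simple_system R P" and P': "simple_system R P'" and l: "linear l"
    and pos: "\<And>x. x \<in> P \<Longrightarrow> l x > (0::real)" and pos': "\<And>x. x \<in> P' \<Longrightarrow> l x > 0"
  shows "P' \<subseteq> P"
proof
  fix x assume x: "x \<in> P'"
  have fin: "finite P" using P by (auto simp: simple_system_def intro: independent_imp_finite)
  obtain h :: "'a \<Rightarrow> real" where h: "linear h" "\<And>y. y \<in> P' \<Longrightarrow> h y = 1"
    using linear_independent_extend[of P' "\<lambda>_. 1"] P' unfolding simple_system_def by blast
  have h1: "h p \<ge> 1" if p: "p \<in> P" for p
  proof -
    have "p \<in> R" using p P by (auto simp: simple_system_def)
    then obtain d :: "'a \<Rightarrow> int" where d: "p = (\<Sum>y\<in>P'. of_int (d y) *\<^sub>R y)" "\<And>y. y \<in> P' \<Longrightarrow> d y \<ge> 0"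
      using simple_system_nonneg_coeffs[OF P' l pos', of p] pos[OF p] by blast
    have "h p = (\<Sum>y\<in>P'. of_int (d y) * h y)"
      using d(1) by (simp add: linear_sum[OF h(1)] linear_cmul[OF h(1)])
    also have "\<dots> = of_int (\<Sum>y\<in>P'. d y)" using h(2) by simp
    finally have hp: "h p = of_int (\<Sum>y\<in>P'. d y)" .
    have fin': "finite P'" using P' by (auto simp: simple_system_def intro: independent_imp_finite)
    have "(\<Sum>y\<in>P'. d y) \<noteq> 0"
    proof
      assume "(\<Sum>y\<in>P'. d y) = 0"
      then have "\<forall>y\<in>P'. d y = 0" using sum_nonneg_eq_0_iff[OF fin', of d] d(2) by blast
      then have "p = 0" using d(1) by simp
      then show False using pos[OF p] linear_0[OF l] by simp
    qed
    moreover have "(\<Sum>y\<in>P'. d y) \<ge> 0" using d(2) by (rule sum_nonneg)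
    ultimately have "(\<Sum>y\<in>P'. d y) \<ge> 1" by linarith
    then show ?thesis unfolding hp by (simp only: of_int_1_le_iff)
  qed
  have "x \<in> R" using x P' by (auto simp: simple_system_def)
  then obtain c :: "'a \<Rightarrow> int" where c: "x = (\<Sum>y\<in>P. of_int (c y) *\<^sub>R y)" "\<And>y. y \<in> P \<Longrightarrow> c y \<ge> 0"
    using simple_system_nonneg_coeffs[OF P l pos, of x] pos'[OF x] by blast
  have "x \<noteq> 0" using pos'[OF x] linear_0[OF l] by auto
  have "\<exists>p\<in>P. c p \<noteq> 0"
  proof (rule ccontr)
    assume "\<not> ?thesis"
    then have "x = 0" using c(1) by simp
    with \<open>x \<noteq> 0\<close> show False ..
  qed
  then obtain p where p: "p \<in> P" "c p \<noteq> 0" by blast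
  have cp: "c p \<ge> 1" using c(2)[OF p(1)] p(2) by linarith
  have "1 = (\<Sum>y\<in>P. of_int (c y) * h y)"
    using h(2)[OF x] c(1) by (metis (mono_tags, lifting) h(1) linear_cmul linear_sum sum.cong real_scaleR_def)
  also have "\<dots> = of_int (c p) * h p + (\<Sum>y\<in>P - {p}. of_int (c y) * h y)"
    using fin p(1) by (rule sum.remove)
  finally have eq: "1 = of_int (c p) * h p + (\<Sum>y\<in>P - {p}. of_int (c y) * h y)" .
  have nonneg: "of_int (c y) * h y \<ge> 0" if "y \<in> P" for y
    using c(2)[OF that] h1[OF that] by simp
  then have S: "(\<Sum>y\<in>P - {p}. of_int (c y) * h y) \<ge> 0" by (intro sum_nonneg) blast
  have "of_int (c p) \<le> of_int (c p) * h p"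
    using cp h1[OF p(1)] by (simp add: mult_le_cancel_left1)
  then have "of_int (c p) \<le> (1::real)" using eq S by linarith
  then have cp1: "c p = 1" using cp by simp
  then have "(\<Sum>y\<in>P - {p}. of_int (c y) * h y) = 0" using eq S h1[OF p(1)] by simp
  then have "\<forall>y\<in>P - {p}. of_int (c y) * h y = 0"
    using sum_nonneg_eq_0_iff[of "P - {p}" "\<lambda>y. of_int (c y) * h y"] fin nonneg by blast
  then have zero: "c y = 0" if "y \<in> P - {p}" for y
    using that h1[of y] by force
  have "x = of_int (c p) *\<^sub>R p + (\<Sum>y\<in>P - {p}. of_int (c y) *\<^sub>R y)"
    unfolding c(1) using fin p(1) by (rule sum.remove)
  also have "\<dots> = p" using cp1 zero by simp
  finally show "x \<in> P" using p(1) by simp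
qed

lemma simple_system_unique:
  assumes "simple_system R P" "simple_system R P'" "linear l"
    and "\<And>x. x \<in> P \<Longrightarrow> l x > (0::real)" "\<And>x. x \<in> P' \<Longrightarrow> l x > 0"
  shows "P = P'"
  using simple_system_subset[OF assms(1,2,3)] simple_system_subset[OF assms(2,1,3)] assms(4,5) by blast

text \<open>The direction \<open>\<phi>\<close> has to avoid, and lie between two neighbouring members of, two arithmetic
  progressions with the same step \<open>\<theta>\<close>.\<close>
lemma common_direction:
  fixes \<theta> \<psi> :: real and M K :: int
  assumes "\<theta> > 0"
  obtains M' :: int and m :: nat and \<phi> :: real
  where "M' \<ge> K" "\<theta> * (M - 1) < \<phi>" "\<phi> < \<theta> * M"
    "\<theta> * (M' - 1) + \<psi> < \<phi> + 2 * pi * m" "\<phi> + 2 * pi * m < \<theta> * M' + \<psi>"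
proof -
  obtain m :: nat where m: "(\<theta> * K - \<theta> * M + \<psi>) / (2 * pi) \<le> real m"
    using real_arch_simple by blast
  \<comment> \<open>On the scale of the second progression, \<open>y\<close> is the position of
    \<open>\<theta> * M\<close> after \<open>m\<close> full turns; \<open>m\<close> was chosen large
    enough for \<open>K \<le> y\<close>.\<close>
  define y where "y = (\<theta> * M + 2 * pi * m - \<psi>) / \<theta>"
  define M' where "M' = \<lceil>y\<rceil>"
  \<comment> \<open>Half the gap between \<open>M' - 1\<close> and \<open>y\<close>: lowering
    \<open>y\<close> by \<open>e\<close> stays strictly between \<open>M' - 1\<close> and
    \<open>M'\<close>, even if \<open>y\<close> is an integer.\<close>
  define e where "e = (1 - (M' - y)) / 2"
  have y: "\<theta> * y = \<theta> * M + 2 * pi * m - \<psi>" using assms by (simp add: y_def)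
  have M': "y \<le> M'" "M' < y + 1" unfolding M'_def by linarith+
  then have e: "0 < e" "e < 1" "M' - 1 < y - e" "y - e < M'" unfolding e_def by (auto simp: field_simps)
  have "\<theta> * K - \<theta> * M + \<psi> \<le> 2 * pi * m" using m by (simp add: field_simps)
  then have "\<theta> * K \<le> \<theta> * y" using y by simp
  then have "K \<le> y" using assms by simp
  then have "K \<le> M'" using M' by linarith
  moreover have "\<theta> * (M - 1) < \<theta> * (M - e)" "\<theta> * (M - e) < \<theta> * M" using assms e by auto
  moreover have "\<theta> * (M' - 1) < \<theta> * (y - e)" "\<theta> * (y - e) < \<theta> * M'" using assms e by simp_all
  moreover have "\<theta> * (y - e) = \<theta> * (M - e) + 2 * pi * m - \<psi>" using y by (simp add: algebra_simps)
  ultimately show ?thesis by (intro that[of M' "\<theta> * (M - e)" m]) auto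
qed

section \<open>Eigenfunctionals of a Coxeter element\<close>

context simply_laced_base
begin

lemma nb_split:
  assumes "factorization I a C xs" "i \<in> I"
  shows "nb i = {j\<in>nb i. precedes xs j i} \<union> {j\<in>nb i. precedes xs i j}"
    and "{j\<in>nb i. precedes xs j i} \<inter> {j\<in>nb i. precedes xs i j} = {}"
proof -
  have "precedes xs j i \<or> precedes xs i j" if "j \<in> nb i" for j
    using that assms nb_subset[of i] nb_irrefl[of i]
    by (intro precedes_total) (auto simp: factorization_def)
  then show "nb i = {j\<in>nb i. precedes xs j i} \<union> {j\<in>nb i. precedes xs i j}" by blast
  show "{j\<in>nb i. precedes xs j i} \<inter> {j\<in>nb i. precedes xs i j} = {}"
    using precedes_asym[of xs] assms(1) unfolding factorization_def by blast
qed

definition slice_height :: "'i list \<Rightarrow> ('i \<Rightarrow> int) \<Rightarrow> bool" where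
  "slice_height xs s \<longleftrightarrow> (\<forall>i\<in>I. \<forall>j\<in>nb i. precedes xs i j \<longrightarrow> s j = s i + 1)"

lemma slice_height_exists:
  assumes "factorization I a C xs"
  obtains s where "slice_height xs s"
proof -
  have "distinct xs" using assms by (simp add: factorization_def)
  then obtain s :: "'i \<Rightarrow> int" where "\<forall>i\<in>I. \<forall>j\<in>I. j \<in> nb i \<and> precedes xs i j \<longrightarrow> s j = s i + 1"
    using exists_height[of "precedes xs" I, OF precedes_asym subset_refl] by blast
  then have "slice_height xs s" using nb_subset unfolding slice_height_def by blast
  then show ?thesis by (rule that)
qed

lemma slice_height_cases:
  assumes "factorization I a C xs" "slice_height xs s" "i \<in> I" "j \<in> nb i"
  shows "s j = s i + 1 \<and> precedes xs i j \<or> s i = s j + 1 \<and> precedes xs j i"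
proof -
  have "j \<in> I" "i \<in> nb j" using assms nb_subset nb_sym by blast+
  then show ?thesis using nb_split(1)[OF assms(1,3)] assms unfolding slice_height_def by blast
qed

text \<open>Multiplication by \<open>cis (- \<theta> * s k)\<close> removes the phases and turns
  \<open>f (C x) = cis (2 * \<theta>) * f x\<close> on simple roots into the eigenvector equation of
  the adjacency matrix for \<open>2 * cos \<theta>\<close>. Stating the exact defect serves both
  directions: constructing \<open>f\<close> and analysing a given one.\<close>

lemma eigenfunctional_defect:
  fixes f :: "'a \<Rightarrow> complex" and \<theta> :: real and v :: "'i \<Rightarrow> complex"
  assumes fac: "factorization I a C xs" and hgt: "slice_height xs s" and f: "linear f" and i: "i \<in> I"
  defines "v \<equiv> \<lambda>k. cis (- \<theta> * s k) * f (slice_root I a C k)"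
  shows "f (C (a i)) - cis (2 * \<theta>) * f (a i)
    = - cis (\<theta> * (s i + 1)) * (2 * cos \<theta> * v i - (\<Sum>j\<in>nb i. v j))"
proof -
  let ?b = "slice_root I a C"
  let ?D = "{j\<in>nb i. precedes xs j i}" and ?U = "{j\<in>nb i. precedes xs i j}"
  let ?q = "cis (\<theta> * (s i + 1))"
  have fin: "finite ?D" "finite ?U" using finite_nb[of i] by simp_all
  have sum_nb: "sum w (nb i) = sum w ?D + sum w ?U" for w :: "'i \<Rightarrow> complex"
    by (subst nb_split(1)[OF fac i]) (rule sum.union_disjoint[OF fin nb_split(2)[OF fac i]])
  have u: "f (?b k) = cis (\<theta> * s k) * v k" for k
    by (simp add: v_def mult.assoc[symmetric] cis_mult)
  have fa: "f (a i) = f (?b i) - (\<Sum>j\<in>?D. f (?b j))"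
    using arg_cong[OF slice_root_recursion[OF fac i], of f] by (simp add: linear_add[OF f] linear_sum[OF f])
  have "f (a i) - f (C (a i)) = 2 * f (?b i) - (\<Sum>j\<in>nb i. f (?b j))"
    using arg_cong[OF simple_root_diff[OF linear_factorization[OF fac] i], of f]
    by (simp add: linear_diff[OF f] linear_sum[OF f] linear_cmul[OF f] scaleR_conv_of_real)
  then have fC: "f (C (a i)) = - f (?b i) + (\<Sum>j\<in>?U. f (?b j))"
    using fa sum_nb[of "\<lambda>j. f (?b j)"] by (simp add: algebra_simps)
  \<comment> \<open>Neighbours before \<open>i\<close> lie one step lower; the factor
    \<open>cis (2 * \<theta>)\<close> lifts them to the phase \<open>?q\<close>, which the
    neighbours after \<open>i\<close> have already.\<close>
  have D: "cis (2 * \<theta>) * f (?b j) = ?q * v j" if "j \<in> ?D" for j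
  proof -
    have "s i = s j + 1"
      using that i hgt nb_subset[of i] nb_sym[of i j] unfolding slice_height_def by blast
    then have "2 * \<theta> + \<theta> * s j = \<theta> * (s i + 1)" by (simp add: algebra_simps)
    then show ?thesis unfolding u by (simp only: mult.assoc[symmetric] cis_mult)
  qed
  have U: "f (?b j) = ?q * v j" if "j \<in> ?U" for j
  proof -
    have "s j = s i + 1" using that i hgt unfolding slice_height_def by blast
    then show ?thesis unfolding u by simp
  qed
  have two_cos: "cis (- \<theta>) + cis \<theta> = of_real (2 * cos \<theta>)"
    by (simp add: complex_eq_iff)
  have "?q * cis (- \<theta>) = cis (\<theta> * s i)" "?q * cis \<theta> = cis (2 * \<theta>) * cis (\<theta> * s i)"
    unfolding cis_mult by (simp_all add: algebra_simps)
  then have "f (?b i) + cis (2 * \<theta>) * f (?b i) = ?q * (cis (- \<theta>) + cis \<theta>) * v i"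
    unfolding u distrib_left distrib_right by (simp add: mult.assoc)
  then have c: "f (?b i) + cis (2 * \<theta>) * f (?b i) = ?q * (2 * cos \<theta> * v i)"
    by (simp only: two_cos mult.assoc)
  have "f (C (a i)) - cis (2 * \<theta>) * f (a i)
    = (\<Sum>j\<in>?U. f (?b j)) + (\<Sum>j\<in>?D. cis (2 * \<theta>) * f (?b j)) - (f (?b i) + cis (2 * \<theta>) * f (?b i))"
    unfolding fC fa by (simp add: algebra_simps sum_distrib_left)
  also have "(\<Sum>j\<in>?U. f (?b j)) = (\<Sum>j\<in>?U. ?q * v j)" using U by (rule sum.cong[OF HOL.refl])
  also have "(\<Sum>j\<in>?D. cis (2 * \<theta>) * f (?b j)) = (\<Sum>j\<in>?D. ?q * v j)" using D by (rule sum.cong[OF HOL.refl])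
  also have "(\<Sum>j\<in>?U. ?q * v j) + (\<Sum>j\<in>?D. ?q * v j) = ?q * (\<Sum>j\<in>nb i. v j)"
    unfolding sum_nb by (simp add: sum_distrib_left algebra_simps)
  finally show ?thesis unfolding c by (simp add: algebra_simps)
qed

lemma linear_eq_on_simple:
  assumes "linear f" "linear g" "\<And>i. i \<in> I \<Longrightarrow> f (a i) = g (a i)"
  shows "f x = g x"
proof -
  have "f (\<Sum>i\<in>I. (\<omega> i \<bullet> x) *\<^sub>R a i) = g (\<Sum>i\<in>I. (\<omega> i \<bullet> x) *\<^sub>R a i)"
    by (simp add: linear_sum[OF assms(1)] linear_sum[OF assms(2)] linear_cmul[OF assms(1)]
        linear_cmul[OF assms(2)] assms(3))
  then show ?thesis using coord_expansion[of x] by simp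
qed

lemma eigenfunctional_exists:
  fixes g :: "'i \<Rightarrow> real" and \<theta> :: real
  assumes fac: "factorization I a C xs" and hgt: "slice_height xs s"
    and g: "\<And>i. i \<in> I \<Longrightarrow> 2 * cos \<theta> * g i = (\<Sum>j\<in>nb i. g j)"
  obtains f :: "'a \<Rightarrow> complex" where "linear f" "\<And>x. f (C x) = cis (2 * \<theta>) * f x"
    "\<And>k. k \<in> I \<Longrightarrow> f (slice_root I a C k) = cis (\<theta> * s k) * g k"
proof -
  let ?u = "\<lambda>k. cis (\<theta> * s k) * g k"
  \<comment> \<open>These are the values on simple roots that \<open>slice_root_recursion\<close>
    forces if the slice roots are to have the values \<open>?u\<close>.\<close>
  define F where "F k = ?u k - (\<Sum>j\<in>{j\<in>nb k. precedes xs j k}. ?u j)" for k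
  define f where "f x = (\<Sum>k\<in>I. (\<omega> k \<bullet> x) *\<^sub>R F k)" for x
  have f: "linear f"
    unfolding f_def
    by (intro linear_compose_sum ballI linearI) (auto simp: inner_add_right scaleR_add_left)
  have fa: "f (a i) = F i" if i: "i \<in> I" for i
  proof -
    have "f (a i) = (\<Sum>k\<in>I. if k = i then F k else 0)"
      unfolding f_def using i by (intro sum.cong) (auto simp: fweight_inner)
    then show ?thesis using i finite_I by simp
  qed
  have fb: "f (slice_root I a C k) = ?u k" if "xs = us @ k # vs" "k \<in> I" for us vs k
    using that
  proof (induction "length us" arbitrary: us k vs rule: less_induct)
    case less
    have d: "distinct (us @ k # vs)" using fac less.prems by (simp add: factorization_def)
    have IH: "f (slice_root I a C j) = ?u j" if r: "j \<in> {j\<in>nb k. precedes xs j k}" for j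
    proof -
      have "j \<in> set us" using r precedes_iff[OF d] less.prems by simp
      then obtain us1 us2 where "us = us1 @ j # us2" by (meson split_list)
      moreover from this have "xs = us1 @ j # (us2 @ k # vs)" using less.prems by simp
      moreover have "j \<in> I" using r nb_subset[of k] by blast
      ultimately show ?thesis using less.hyps[of us1 j "us2 @ k # vs"] by simp
    qed
    have "f (slice_root I a C k) = F k + (\<Sum>j\<in>{j\<in>nb k. precedes xs j k}. f (slice_root I a C j))"
      by (subst slice_root_recursion[OF fac less.prems(2)])
        (simp only: linear_add[OF f] linear_sum[OF f] fa[OF less.prems(2)])
    also have "\<dots> = ?u k" unfolding F_def using IH by simp
    finally show ?case .
  qed
  have fb: "f (slice_root I a C k) = ?u k" if "k \<in> I" for k
    using factorization_split[OF fac that] fb that by blast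
  have "f (C (a i)) = cis (2 * \<theta>) * f (a i)" if i: "i \<in> I" for i
  proof -
    have v: "cis (- \<theta> * s k) * f (slice_root I a C k) = g k" if "k \<in> I" for k
      using fb[OF that] by (simp add: mult.assoc[symmetric] cis_mult)
    have "(\<Sum>j\<in>nb i. cis (- \<theta> * s j) * f (slice_root I a C j)) = (\<Sum>j\<in>nb i. of_real (g j))"
      by (intro sum.cong) (use v nb_subset[of i] in auto)
    also have "\<dots> = 2 * cos \<theta> * of_real (g i)"
      using arg_cong[OF g[OF i], of complex_of_real] by simp
    finally show ?thesis using eigenfunctional_defect[OF fac hgt f i, of \<theta>] v[OF i] by simp
  qed
  moreover have "linear (\<lambda>x. f (C x))"
    using linear_compose[OF linear_factorization[OF fac] f] by (simp add: o_def)
  moreover have "linear (\<lambda>x. cis (2 * \<theta>) * f x)"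
    by (rule linearI) (simp_all add: linear_add[OF f] linear_cmul[OF f] algebra_simps)
  ultimately have "f (C x) = cis (2 * \<theta>) * f x" for x
    using linear_eq_on_simple[of "\<lambda>x. f (C x)" "\<lambda>x. cis (2 * \<theta>) * f x"] by blast
  then show ?thesis using that f fb by blast
qed

context
  fixes C xs s \<theta> and f :: "'a \<Rightarrow> complex" and g :: "'i \<Rightarrow> real" and \<mu> :: real
  assumes fac: "factorization I a C xs" and hgt: "slice_height xs s"
    and f: "linear f" and fC: "\<And>x. f (C x) = cis (2 * \<theta>) * f x"
    and g: "\<And>i. i \<in> I \<Longrightarrow> g i > 0" "\<And>i. i \<in> I \<Longrightarrow> \<mu> * g i = (\<Sum>j\<in>nb i. g j)"
begin

private definition v :: "'i \<Rightarrow> complex" where "v k = cis (- \<theta> * s k) * f (slice_root I a C k)"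

private lemma v_eigen:
  assumes "i \<in> I"
  shows "2 * cos \<theta> * v i = (\<Sum>j\<in>nb i. v j)"
  using eigenfunctional_defect[OF fac hgt f assms, of \<theta>] fC[of "a i"] by (simp add: v_def)

private lemma v_eigen_Re_Im:
  assumes "i \<in> I"
  shows "2 * cos \<theta> * Re (v i) = (\<Sum>j\<in>nb i. Re (v j))" "2 * cos \<theta> * Im (v i) = (\<Sum>j\<in>nb i. Im (v j))"
  using arg_cong[OF v_eigen[OF assms], of Re] arg_cong[OF v_eigen[OF assms], of Im] by simp_all

text \<open>If all \<open>v k\<close> vanished, so would \<open>f\<close>. Otherwise the real or the
  imaginary part of \<open>v\<close> is a non-zero real eigenvector for
  \<open>2 * cos \<theta>\<close>, to which \<open>perron_maximal\<close> applies.\<close>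

lemma eigenvalue_le:
  assumes "f x \<noteq> 0"
  shows "2 * cos \<theta> \<le> \<mu>"
proof -
  have "\<exists>k\<in>I. v k \<noteq> 0"
  proof (rule ccontr)
    assume "\<not> ?thesis"
    then have z: "f (slice_root I a C k) = 0" if "k \<in> I" for k using that by (simp add: v_def)
    have "f (a i) = 0" if i: "i \<in> I" for i
    proof -
      have "(\<Sum>j\<in>{j\<in>nb i. precedes xs j i}. f (slice_root I a C j)) = 0"
        using z nb_subset[of i] by (intro sum.neutral) blast
      then show ?thesis
        using arg_cong[OF slice_root_recursion[OF fac i], of f] z[OF i]
        by (simp add: linear_add[OF f] linear_sum[OF f])
    qed
    then have "f x = 0"
      using linear_eq_on_simple[OF f linear_zero] by blast
    then show False using assms by simp
  qed
  then obtain k where k: "k \<in> I" "v k \<noteq> 0" by blast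
  then have "Re (v k) \<noteq> 0 \<or> Im (v k) \<noteq> 0" by (simp add: complex_eq_iff)
  then show ?thesis
    using perron_maximal[OF g v_eigen_Re_Im(1) k(1)] perron_maximal[OF g v_eigen_Re_Im(2) k(1)] by blast
qed

text \<open>Real and imaginary part of \<open>v\<close> are both multiples of the Perron
  eigenvector; the two factors combine to a complex scalar.\<close>

lemma eigenfunctional_proportional:
  assumes "irreducible_rs R" "2 * cos \<theta> = \<mu>"
  shows "\<exists>c. \<forall>k\<in>I. f (slice_root I a C k) = c * cis (\<theta> * s k) * g k"
proof -
  obtain c d where "\<forall>i\<in>I. Re (v i) = c * g i" "\<forall>i\<in>I. Im (v i) = d * g i"
    using perron_unique[OF assms(1) g, of "\<lambda>i. Re (v i)"] perron_unique[OF assms(1) g, of "\<lambda>i. Im (v i)"]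
      v_eigen_Re_Im assms(2) by blast
  then have "v k = Complex c d * g k" if "k \<in> I" for k
    using that by (simp add: complex_eq_iff)
  moreover have "f (slice_root I a C k) = cis (\<theta> * s k) * v k" for k
    by (simp add: v_def mult.assoc[symmetric] cis_mult)
  ultimately show ?thesis by (intro exI[of _ "Complex c d"]) (simp add: algebra_simps)
qed

end

text \<open>If the orientation is bipartite, with heights \<open>M\<close> and \<open>M + 1\<close>, then all simple roots are mapped
  onto the two rays with arguments \<open>\<psi> + M\<theta>\<close> and \<open>\<psi> + (M - 1)\<theta> + \<pi>\<close>.\<close>
lemma bipartite_positive:
  fixes f :: "'a \<Rightarrow> complex" and g :: "'i \<Rightarrow> real" and M :: int
  assumes fac: "factorization I a C xs" and hgt: "slice_height xs s" and f: "linear f"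
    and level: "\<And>k. k \<in> I \<Longrightarrow> s k \<in> {M, M + 1}"
    and g: "\<And>i. i \<in> I \<Longrightarrow> g i > 0" "\<And>i. i \<in> I \<Longrightarrow> 2 * cos \<theta> * g i = (\<Sum>j\<in>nb i. g j)"
    and fb: "\<And>k. k \<in> I \<Longrightarrow> f (slice_root I a C k) = rcis r (\<psi> + \<theta> * s k) * g k" and "r > 0"
    and \<theta>: "\<theta> \<le> pi / 2" and \<phi>: "\<theta> * (M - 1) + \<psi> < \<phi>" "\<phi> < \<theta> * M + \<psi>" and i: "i \<in> I"
  shows "Im (cis (- \<phi>) * f (a i)) > 0"
proof -
  have fa: "f (a i) = f (slice_root I a C i) - (\<Sum>j\<in>{j\<in>nb i. precedes xs j i}. f (slice_root I a C j))"
    using arg_cong[OF slice_root_recursion[OF fac i], of f] by (simp add: linear_add[OF f] linear_sum[OF f])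
  have nbI: "j \<in> I" if "j \<in> nb i" for j using that nb_subset by blast
  note cases = slice_height_cases[OF fac hgt i]
  have distinct: "distinct xs" using fac by (simp add: factorization_def)
  show ?thesis
  proof (cases "s i = M")
    case True
    \<comment> \<open>On the lower level \<open>i\<close> is a source, so its simple root is its
      slice root.\<close>
    have "{j\<in>nb i. precedes xs j i} = {}"
    proof -
      have "\<not> precedes xs j i" if "j \<in> nb i" for j
      proof -
        have "s j \<ge> M" using level[OF nbI[OF that]] by auto
        then have "s i \<noteq> s j + 1" using True by linarith
        then show ?thesis using cases[OF that] precedes_asym[OF distinct] by blast
      qed
      then show ?thesis by blast
    qed
    then have "f (a i) = rcis r (\<psi> + \<theta> * M) * g i" unfolding fa using fb[OF i] True by (simp only: sum.empty) simp
    then have "Im (cis (- \<phi>) * f (a i)) = r * g i * sin (\<psi> + \<theta> * M - \<phi>)"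
      by (simp add: rcis_def sin_diff algebra_simps)
    moreover have "sin (\<psi> + \<theta> * M - \<phi>) > 0"
      using \<phi> \<theta> pi_gt_zero by (intro sin_gt_zero) (auto simp: algebra_simps)
    ultimately show ?thesis using \<open>r > 0\<close> g(1)[OF i] by simp
  next
    case False
    then have si: "s i = M + 1" using level[OF i] by simp
    \<comment> \<open>On the upper level \<open>i\<close> is a sink: all its neighbours precede
      it.\<close>
    have sj: "precedes xs j i \<and> s j = M" if "j \<in> nb i" for j
    proof -
      have "s j \<le> M + 1" using level[OF nbI[OF that]] by auto
      then have "s j \<noteq> s i + 1" using si by linarith
      then show ?thesis using cases[OF that] si by auto
    qed
    then have "{j\<in>nb i. precedes xs j i} = nb i" by blast
    then have "f (a i) = f (slice_root I a C i) - (\<Sum>j\<in>nb i. f (slice_root I a C j))" using fa by simp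
    also have "(\<Sum>j\<in>nb i. f (slice_root I a C j)) = (\<Sum>j\<in>nb i. rcis r (\<psi> + \<theta> * M) * g j)"
      by (intro sum.cong) (use fb nbI sj in auto)
    also have "\<dots> = rcis r (\<psi> + \<theta> * M) * of_real (2 * cos \<theta> * g i)"
      unfolding g(2)[OF i] by (simp add: sum_distrib_left)
    finally have "f (a i) = rcis r (\<psi> + \<theta> * (M + 1)) * g i - rcis r (\<psi> + \<theta> * M) * of_real (2 * cos \<theta> * g i)"
      using fb[OF i] si by simp
    then have fa': "f (a i) = of_real (r * g i) * (cis (\<psi> + \<theta> * M + \<theta>) - 2 * cos \<theta> * cis (\<psi> + \<theta> * M))"
      by (simp add: rcis_def algebra_simps)
    \<comment> \<open>This identity sends the simple roots at sinks to the ray opposite to the phase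
      one step below the lower level.\<close>
    have "cis (x + \<theta>) - 2 * cos \<theta> * cis x = - cis (x - \<theta>)" for x
      by (simp add: complex_eq_iff cos_add sin_add cos_diff sin_diff)
    then have "f (a i) = - of_real (r * g i) * cis (\<psi> + \<theta> * M - \<theta>)" unfolding fa' by simp
    moreover have "Im (cis (- \<phi>) * (- of_real w * cis t)) = w * sin (\<phi> - t)" for w t
      by (simp add: sin_diff algebra_simps)
    ultimately have "Im (cis (- \<phi>) * f (a i)) = r * g i * sin (\<phi> - (\<psi> + \<theta> * M - \<theta>))"
      by simp
    moreover have "sin (\<phi> - (\<psi> + \<theta> * M - \<theta>)) > 0"
      using \<phi> \<theta> pi_gt_zero by (intro sin_gt_zero) (auto simp: algebra_simps)
    ultimately show ?thesis using \<open>r > 0\<close> g(1)[OF i] by simp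
  qed
qed

end

text \<open>Each family has its own Perron eigenvalue a priori. Its eigenfunctional is one of the
  same \<open>C\<close> for the other family too, so each eigenvalue bounds the other. Once they
  agree, \<open>eigenfunctional_proportional\<close> expresses \<open>f\<close> on the slice roots
  of \<open>a'\<close> by \<open>g'\<close>; \<open>r\<close> and \<open>\<psi>\<close> are the
  polar coordinates of the scalar.\<close>

lemma common_eigenfunctional:
  fixes R :: "'a::euclidean_space set" and C :: "'a \<Rightarrow> 'a"
  assumes B: "simply_laced_base R I a" and B': "simply_laced_base R I a'" and irr: "irreducible_rs R"
    and fac: "factorization I a C xs" and hgt: "simply_laced_base.slice_height I a xs s"
    and fac': "factorization I a' C xs'" and hgt': "simply_laced_base.slice_height I a' xs' s'"
    and "k \<in> I"
  obtains \<theta> :: real and f :: "'a \<Rightarrow> complex" and g g' :: "'i \<Rightarrow> real" and r \<psi> :: real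
  where "0 < \<theta>" "\<theta> \<le> pi / 2" "linear f" "\<forall>x. f (C x) = cis (2 * \<theta>) * f x"
    "\<forall>i\<in>I. g i > 0" "\<forall>i\<in>I. g' i > 0" "r > 0"
    "\<forall>i\<in>I. 2 * cos \<theta> * g i = (\<Sum>j\<in>nbrs I a i. g j)"
    "\<forall>i\<in>I. 2 * cos \<theta> * g' i = (\<Sum>j\<in>nbrs I a' i. g' j)"
    "\<forall>i\<in>I. f (slice_root I a C i) = cis (\<theta> * s i) * g i"
    "\<forall>i\<in>I. f (slice_root I a' C i) = rcis r (\<psi> + \<theta> * s' i) * g' i"
proof -
  interpret A: simply_laced_base R I a by (rule B)
  interpret A': simply_laced_base R I a' by (rule B')
  obtain \<mu> :: real and g where \<mu>: "0 \<le> \<mu>" "\<mu> < 2" and g: "\<And>i. i \<in> I \<Longrightarrow> 0 < g i"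
      "\<And>i. i \<in> I \<Longrightarrow> \<mu> * g i = (\<Sum>j\<in>nbrs I a i. g j)"
    using A.perron_exists[OF irr] by blast
  obtain \<mu>' :: real and g' where \<mu>': "0 \<le> \<mu>'" "\<mu>' < 2" and g': "\<And>i. i \<in> I \<Longrightarrow> 0 < g' i"
      "\<And>i. i \<in> I \<Longrightarrow> \<mu>' * g' i = (\<Sum>j\<in>nbrs I a' i. g' j)"
    using A'.perron_exists[OF irr] by blast
  define \<theta> where "\<theta> = arccos (\<mu> / 2)"
  define \<theta>' where "\<theta>' = arccos (\<mu>' / 2)"
  have cos: "2 * cos \<theta> = \<mu>" "2 * cos \<theta>' = \<mu>'"
    using \<mu> \<mu>' by (simp_all add: \<theta>_def \<theta>'_def cos_arccos)
  obtain f :: "'a \<Rightarrow> complex" where f: "linear f" "\<And>x. f (C x) = cis (2 * \<theta>) * f x"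
      "\<And>k. k \<in> I \<Longrightarrow> f (slice_root I a C k) = cis (\<theta> * s k) * g k"
    using A.eigenfunctional_exists[OF fac hgt, of \<theta> g] g cos by metis
  obtain f' :: "'a \<Rightarrow> complex" where f': "linear f'" "\<And>x. f' (C x) = cis (2 * \<theta>') * f' x"
      "\<And>k. k \<in> I \<Longrightarrow> f' (slice_root I a' C k) = cis (\<theta>' * s' k) * g' k"
    using A'.eigenfunctional_exists[OF fac' hgt', of \<theta>' g'] g' cos by metis
  have ne: "f (slice_root I a C k) \<noteq> 0" "f' (slice_root I a' C k) \<noteq> 0"
    using f(3) f'(3) g(1) g'(1) \<open>k \<in> I\<close> by fastforce+
  have "\<mu> \<le> \<mu>'" using A'.eigenvalue_le[OF fac' hgt' f(1,2) g' ne(1)] cos by simp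
  moreover have "\<mu>' \<le> \<mu>" using A.eigenvalue_le[OF fac hgt f'(1,2) g ne(2)] cos by simp
  ultimately have eq: "\<mu>' = \<mu>" by simp
  obtain c where c: "\<And>i. i \<in> I \<Longrightarrow> f (slice_root I a' C i) = c * cis (\<theta> * s' i) * g' i"
    using A'.eigenfunctional_proportional[OF fac' hgt' f(1,2) g' irr] cos eq by metis
  \<comment> \<open>For \<open>c = 0\<close> the functional would vanish on all slice roots of
    \<open>a'\<close>, by the recursion on all \<open>a' i\<close>, and hence everywhere.\<close>
  have "c \<noteq> 0"
  proof
    assume "c = 0"
    then have z: "f (slice_root I a' C i) = 0" if "i \<in> I" for i using c[OF that] by simp
    have "f (a' i) = 0" if i: "i \<in> I" for i
    proof -
      have "(\<Sum>j\<in>{j\<in>nbrs I a' i. precedes xs' j i}. f (slice_root I a' C j)) = 0"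
        using z A'.nb_subset[of i] by (intro sum.neutral) blast
      then show ?thesis
        using arg_cong[OF A'.slice_root_recursion[OF fac' i], of f] z[OF i]
        by (simp add: linear_add[OF f(1)] linear_sum[OF f(1)])
    qed
    then show False using A'.linear_eq_on_simple[OF f(1) linear_zero] ne(1) by blast
  qed
  show ?thesis
  proof (rule that[where \<theta> = \<theta> and f = f and g = g and g' = g' and r = "cmod c" and \<psi> = "Arg c"])
    show "0 < \<theta>" using \<mu> arccos_lt_bounded[of "\<mu> / 2"] by (simp add: \<theta>_def)
    show "\<theta> \<le> pi / 2" using \<mu> arccos_le_pi2[of "\<mu> / 2"] by (simp add: \<theta>_def)
    show "\<forall>i\<in>I. f (slice_root I a' C i) = rcis (cmod c) (Arg c + \<theta> * s' i) * g' i"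
    proof
      fix i assume i: "i \<in> I"
      have "c = rcis (cmod c) (Arg c)" by (simp add: rcis_cmod_Arg)
      then show "f (slice_root I a' C i) = rcis (cmod c) (Arg c + \<theta> * s' i) * g' i"
        using c[OF i] by (metis cis_rcis_eq mult.right_neutral rcis_mult)
    qed
  qed (use f g g' cos eq \<open>c \<noteq> 0\<close> in auto)
qed

section \<open>Source reflections\<close>

lemma simple_system_refl_image:
  assumes P: "simple_system R P" and b: "b \<noteq> 0" "refl_root b ` R \<subseteq> R"
  shows "simple_system R (refl_root b ` P)"
  unfolding simple_system_def
proof (intro conjI ballI)
  let ?r = "refl_root b"
  have inv: "?r (?r x) = x" for x using b(1) by (rule refl_root_involutive)
  then have inj: "inj_on ?r A" for A by (metis inj_onI)
  show "?r ` P \<subseteq> R" using P b(2) by (auto simp: simple_system_def)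
  show "independent (?r ` P)"
    using P inj by (intro linear_independent_injective_image linear_refl_root) (auto simp: simple_system_def)
  have "span (?r ` P) = ?r ` UNIV"
    using P linear_span_image[OF linear_refl_root, of b P] by (simp add: simple_system_def)
  also have "\<dots> = UNIV" using inv by (metis surjI)
  finally show "span (?r ` P) = UNIV" .
  fix y assume "y \<in> R"
  then have "?r y \<in> R" using b(2) by blast
  then obtain c :: "'a \<Rightarrow> int" where c: "?r y = (\<Sum>x\<in>P. of_int (c x) *\<^sub>R x)"
      "(\<forall>x\<in>P. c x \<ge> 0) \<or> (\<forall>x\<in>P. c x \<le> 0)"
    using P unfolding simple_system_def by blast
  have "y = ?r (\<Sum>x\<in>P. of_int (c x) *\<^sub>R x)" using c(1) inv by metis
  also have "\<dots> = (\<Sum>x\<in>?r ` P. of_int (c (?r x)) *\<^sub>R x)"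
    by (simp add: sum.reindex[OF inj] inv linear_sum[OF linear_refl_root] linear_cmul[OF linear_refl_root])
  finally show "\<exists>c. y = (\<Sum>x\<in>?r ` P. of_int (c x) *\<^sub>R x) \<and>
      ((\<forall>x\<in>?r ` P. c x \<ge> 0) \<or> (\<forall>x\<in>?r ` P. c x \<le> 0))"
    using c(2) inv by (intro exI[of _ "\<lambda>x. c (?r x)"]) auto
qed

lemma refl_product_commute:
  assumes "\<And>x. x \<in> set bs \<Longrightarrow> b \<bullet> x = 0"
  shows "refl_product bs \<circ> refl_root b = refl_root b \<circ> refl_product bs"
  using assms
proof (induction bs)
  case (Cons x bs)
  have "refl_root x (refl_root b y) = refl_root b (refl_root x y)" for y
    using Cons.prems[of x]
    by (simp add: refl_root_def inner_diff_left inner_commute[of x b] algebra_simps)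
  moreover have "refl_product bs (refl_root b y) = refl_root b (refl_product bs y)" for y
    using Cons by (auto simp: fun_eq_iff)
  ultimately show ?case by (simp add: fun_eq_iff)
qed simp

section \<open>Compatible simple systems as slices, and moves between them\<close>

locale indexed_root_system =
  fixes R :: "'a::euclidean_space set" and I :: "'i set" and \<alpha> :: "'a set \<Rightarrow> 'i \<Rightarrow> 'a"
  assumes root_system: "root_system R"
    and simply_laced: "simply_laced_normalized R"
    and irreducible: "irreducible_rs R"
    and indexing: "simple_root_indexing R I \<alpha>"
begin

lemma bij_simple: "simple_system R P \<Longrightarrow> bij_betw (\<alpha> P) I P"
  using indexing by (simp add: simple_root_indexing_def)

lemma base: "simple_system R P \<Longrightarrow> simply_laced_base R I (\<alpha> P)"
  using bij_simple[of P] root_system simply_laced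
  by (auto simp: simply_laced_base_def bij_betw_def)

lemma refl_indexing:
  assumes "simple_system R P" "b \<in> R" "k \<in> I"
  shows "\<alpha> (refl_root b ` P) k = refl_root b (\<alpha> P k)"
proof -
  have "refl_root b \<circ> id \<in> weyl_group R"
    using assms(2) by (intro weyl_group.intros)
  then show ?thesis using indexing assms unfolding simple_root_indexing_def by (metis comp_id)
qed

abbreviation "nb P \<equiv> nbrs I (\<alpha> P)"
abbreviation "sroot C P \<equiv> slice_root I (\<alpha> P) C"

text \<open>The height function \<open>s\<close> describes the slice of the universal cover of \<open>I_hat\<close> that belongs to \<open>P\<close>.\<close>
definition slice :: "('a \<Rightarrow> 'a) \<Rightarrow> 'a set \<Rightarrow> ('i \<Rightarrow> int) \<Rightarrow> bool" where
  "slice C P s \<longleftrightarrow> simple_system R P \<and>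
    (\<exists>xs. factorization I (\<alpha> P) C xs \<and> simply_laced_base.slice_height I (\<alpha> P) xs s)"

lemma compatible_slice:
  assumes "compatible R I \<alpha> C P"
  obtains s where "slice C P s"
proof -
  have P: "simple_system R P" and "\<exists>xs. factorization I (\<alpha> P) C xs"
    using assms by (auto simp: compatible_def coxeter_expression_def factorization_def)
  then obtain xs where xs: "factorization I (\<alpha> P) C xs" by blast
  obtain s where "simply_laced_base.slice_height I (\<alpha> P) xs s"
    using simply_laced_base.slice_height_exists[OF base[OF P] xs] by blast
  then show ?thesis using that P xs unfolding slice_def by blast
qed

text \<open>\<open>arrow\<close> asks for some expression of \<open>C\<close>; by
  \<open>precedes_independent\<close> any given one decides.\<close>

lemma arrow_iff:
  assumes P: "simple_system R P" and xs: "factorization I (\<alpha> P) C xs"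
  shows "arrow I \<alpha> C P i j \<longleftrightarrow> j \<in> I \<and> i \<in> nb P j \<and> precedes xs i j"
proof -
  interpret B: simply_laced_base R I "\<alpha> P" by (rule base[OF P])
  have edge: "i \<in> I \<and> j \<in> I \<and> i \<noteq> j \<and> edge_number \<alpha> P i j = 1 \<longleftrightarrow> j \<in> I \<and> i \<in> nb P j"
    using B.a_norm by (auto simp: edge_number_def nbrs_def inner_commute)
  have "(\<exists>is k l. coxeter_expression I \<alpha> C P is \<and> k < l \<and> l < length is \<and> is ! k = i \<and> is ! l = j)
      \<longleftrightarrow> (\<exists>ys. factorization I (\<alpha> P) C ys \<and> precedes ys i j)"
    unfolding precedes_nth factorization_def coxeter_expression_def by blast
  then have "arrow I \<alpha> C P i j \<longleftrightarrow>
      j \<in> I \<and> i \<in> nb P j \<and> (\<exists>ys. factorization I (\<alpha> P) C ys \<and> precedes ys i j)"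
    unfolding arrow_def using edge by blast
  then show ?thesis using B.precedes_independent xs by blast
qed

lemma beta_eq_slice_root:
  assumes P: "simple_system R P" and xs: "factorization I (\<alpha> P) C xs" and i: "i \<in> I"
  shows "beta I \<alpha> C P i = sroot C P i"
proof -
  interpret B: simply_laced_base R I "\<alpha> P" by (rule base[OF P])
  have arr: "arrow I \<alpha> C P = (\<lambda>j i. i \<in> I \<and> j \<in> nb P i \<and> precedes xs j i)"
    using arrow_iff[OF P xs] by (intro ext) simp
  have "sroot C P i = (\<Sum>j\<in>I. (B.\<omega> j \<bullet> sroot C P i) *\<^sub>R \<alpha> P j)" by (rule B.coord_expansion)
  also have "\<dots> = (\<Sum>j\<in>I. if (arrow I \<alpha> C P)\<^sup>*\<^sup>* j i then \<alpha> P j else 0)"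
    unfolding arr by (intro sum.cong HOL.refl) (simp add: B.slice_root_support[OF xs i])
  also have "\<dots> = (\<Sum>j\<in>{j\<in>I. (arrow I \<alpha> C P)\<^sup>*\<^sup>* j i}. \<alpha> P j)"
    using B.finite_I by (simp add: sum.inter_filter)
  finally show ?thesis by (simp add: beta_def)
qed

lemma slice_nb_cases:
  assumes "slice C P s" "i \<in> I" "j \<in> nb P i"
  shows "s j = s i + 1 \<and> arrow I \<alpha> C P i j \<or> s i = s j + 1 \<and> arrow I \<alpha> C P j i"
proof -
  from assms(1) obtain xs where xs: "simple_system R P" "factorization I (\<alpha> P) C xs"
      "simply_laced_base.slice_height I (\<alpha> P) xs s"
    by (auto simp: slice_def)
  interpret B: simply_laced_base R I "\<alpha> P" by (rule base[OF xs(1)])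
  have "j \<in> I" "i \<in> nb P j" using assms B.nb_subset[of i] B.nb_sym by blast+
  then show ?thesis
    using B.slice_height_cases[OF xs(2,3) assms(2,3)] arrow_iff[OF xs(1,2)] assms by blast
qed

lemma arrow_height:
  assumes "slice C P s" "arrow I \<alpha> C P i j"
  shows "i \<in> I" "j \<in> nb P i" "s j = s i + 1"
proof -
  from assms(1) obtain xs where xs: "simple_system R P" "factorization I (\<alpha> P) C xs"
      "simply_laced_base.slice_height I (\<alpha> P) xs s"
    by (auto simp: slice_def)
  interpret B: simply_laced_base R I "\<alpha> P" by (rule base[OF xs(1)])
  have *: "j \<in> I" "i \<in> nb P j" "precedes xs i j" using arrow_iff[OF xs(1,2)] assms(2) by blast+
  then show "i \<in> I" "j \<in> nb P i" using B.nb_subset B.nb_sym by blast+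
  then show "s j = s i + 1" using xs(3) * unfolding B.slice_height_def by blast
qed

lemma slice_beta: "slice C P s \<Longrightarrow> i \<in> I \<Longrightarrow> beta I \<alpha> C P i = sroot C P i"
  using beta_eq_slice_root by (auto simp: slice_def)

lemma slice_root_in_R:
  assumes "slice C P s" "i \<in> I"
  shows "sroot C P i \<in> R"
proof -
  from assms(1) obtain xs where xs: "simple_system R P" "factorization I (\<alpha> P) C xs"
    by (auto simp: slice_def)
  interpret B: simply_laced_base R I "\<alpha> P" by (rule base[OF xs(1)])
  obtain us vs where "xs = us @ i # vs" using B.factorization_split[OF xs(2) assms(2)] by blast
  then show ?thesis using B.slice_root_coords(1)[of C us i vs] xs(2) by simp
qed

lemma slice_preserves_R:
  assumes "slice C P s" "x \<in> R"
  shows "C x \<in> R"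
proof -
  from assms(1) obtain xs where xs: "simple_system R P" "factorization I (\<alpha> P) C xs"
    by (auto simp: slice_def)
  interpret B: simply_laced_base R I "\<alpha> P" by (rule base[OF xs(1)])
  have "refl_product (map (\<alpha> P) ys) x \<in> R" if "set ys \<subseteq> I" for ys
    using that by (induction ys) (auto simp: assms(2) B.refl_in_R B.a_in_R)
  then show ?thesis using xs(2) by (simp add: factorization_def)
qed

text \<open>Reflecting in a source \<open>i\<close> moves \<open>i\<close> from the beginning to the end of the expression of \<open>C\<close>.\<close>
lemma source_reflection:
  assumes sl: "slice C P s" and i: "i \<in> I" and source: "\<And>j. j \<in> nb P i \<Longrightarrow> s j = s i + 1"
  defines "P1 \<equiv> refl_root (\<alpha> P i) ` P"
  shows "slice C P1 (s(i := s i + 2))"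
    and "k \<in> I \<Longrightarrow> nb P1 k = nb P k"
    and "k \<in> I \<Longrightarrow> sroot C P1 k = (if k = i then C (sroot C P i) else sroot C P k)"
proof -
  let ?r = "refl_root (\<alpha> P i)"
  from sl obtain xs where P: "simple_system R P" and xs: "factorization I (\<alpha> P) C xs"
      and hgt: "simply_laced_base.slice_height I (\<alpha> P) xs s"
    by (auto simp: slice_def)
  interpret B: simply_laced_base R I "\<alpha> P" by (rule base[OF P])
  have ai: "\<alpha> P i \<in> R" "\<alpha> P i \<noteq> 0" using B.a_in_R[OF i] B.a_norm[OF i] by auto
  have P1: "simple_system R P1"
    unfolding P1_def using P ai B.refl_in_R by (intro simple_system_refl_image) blast+
  interpret B1: simply_laced_base R I "\<alpha> P1" by (rule base[OF P1])
  have a1: "\<alpha> P1 k = ?r (\<alpha> P k)" if "k \<in> I" for k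
    unfolding P1_def using P ai(1) that by (rule refl_indexing)
  show nb1: "nb P1 k = nb P k" if "k \<in> I" for k
    using that unfolding nbrs_def by (auto simp: a1 inner_refl_root ai(2))
  obtain us vs where us: "xs = us @ i # vs" using B.factorization_split[OF xs i] by blast
  have dist: "distinct (us @ i # vs)" and set: "set (us @ i # vs) = I"
    using xs us by (auto simp: factorization_def)
  have no_pred: "\<not> precedes xs j i" if j: "j \<in> nb P i" for j
    using B.slice_height_cases[OF xs hgt i j] source[OF j] precedes_asym[of xs i j] dist us by auto
  \<comment> \<open>A non-orthogonal factor to the left of \<open>i\<close> would be a neighbour
    preceding it. So the reflection at \<open>i\<close> commutes to the front.\<close>
  have orth: "\<alpha> P i \<bullet> \<alpha> P j = 0" if "j \<in> set us" for j
  proof -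
    have "precedes xs j i" using precedes_iff[OF dist] that us by simp
    moreover have "j \<in> I" "i \<noteq> j" using that set dist by auto
    ultimately show ?thesis using no_pred B.simple_inner_cases[OF i] by auto
  qed
  let ?Q = "refl_product (map (\<alpha> P) (us @ vs))"
  have "C = (refl_product (map (\<alpha> P) us) \<circ> ?r) \<circ> refl_product (map (\<alpha> P) vs)"
    using xs us by (simp add: factorization_def refl_product_append o_assoc)
  also have "refl_product (map (\<alpha> P) us) \<circ> ?r = ?r \<circ> refl_product (map (\<alpha> P) us)"
    using orth by (intro refl_product_commute) auto
  finally have C: "C = ?r \<circ> ?Q" by (simp only: map_append refl_product_append o_assoc)
  \<comment> \<open>For the reflected system the factors of \<open>?Q\<close> are conjugated by
    \<open>?r\<close>, so this order yields
    \<open>?r \<circ> ?Q \<circ> ?r \<circ> ?r = C\<close>.\<close>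
  let ?ys = "us @ vs @ [i]"
  have "map (\<alpha> P1) (us @ vs) = map ?r (map (\<alpha> P) (us @ vs))"
    using a1 set by auto
  then have "refl_product (map (\<alpha> P1) (us @ vs)) = ?r \<circ> ?Q \<circ> ?r"
    using refl_product_conjugate[OF ai(2), of "map (\<alpha> P) (us @ vs)"] by (simp only:)
  moreover have "refl_product (map (\<alpha> P1) ?ys) = refl_product (map (\<alpha> P1) (us @ vs)) \<circ> refl_root (\<alpha> P1 i)"
    by (simp add: refl_product_append o_assoc)
  moreover have "refl_root (\<alpha> P1 i) = ?r"
    unfolding a1[OF i] by (auto simp: fun_eq_iff refl_root_conjugate[OF ai(2)] refl_root_involutive[OF ai(2)])
  ultimately have "refl_product (map (\<alpha> P1) ?ys) = C"
    unfolding C by (auto simp: fun_eq_iff refl_root_involutive[OF ai(2)])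
  then have ys: "factorization I (\<alpha> P1) C ?ys"
    using dist set by (auto simp: factorization_def)
  have "(s(i := s i + 2)) k = (s(i := s i + 2)) j + 1"
    if j: "j \<in> I" and k: "k \<in> nb P1 j" and prec: "precedes ?ys j k" for j k
  proof -
    have k': "k \<in> nb P j" using k nb1[OF j] by simp
    then have kI: "k \<in> I" and ne: "k \<noteq> j" using B.nb_subset B.nb_irrefl by blast+
    \<comment> \<open>Nothing comes after \<open>i\<close>, the last entry of
      \<open>?ys\<close>.\<close>
    have "j \<noteq> i" using prec dist ne by (auto simp: precedes_append dest: precedes_in_set)
    show ?thesis
    proof (cases "k = i")
      case True
      then have "s j = s i + 1" using source[of j] B.nb_sym[OF j k'] by simp
      then show ?thesis using True \<open>j \<noteq> i\<close> by simp
    next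
      case False
      have "precedes xs j k"
        using prec False \<open>j \<noteq> i\<close> unfolding us by (auto simp: precedes_append)
      then show ?thesis
        using hgt j k' False \<open>j \<noteq> i\<close> unfolding B.slice_height_def by simp
    qed
  qed
  then have "B1.slice_height ?ys (s(i := s i + 2))" unfolding B1.slice_height_def by blast
  then show "slice C P1 (s(i := s i + 2))" unfolding slice_def using P1 ys by blast
  have w1: "B1.\<omega> k = ?r (B.\<omega> k)" if k: "k \<in> I" for k
    using k by (intro B1.fweight_unique[symmetric]) (auto simp: a1 inner_refl_root ai(2) B.fweight_inner)
  have w1': "B1.\<omega> k = B.\<omega> k - (if k = i then \<alpha> P i else 0)" if k: "k \<in> I" for k
    using k i by (simp add: w1 refl_root_norm_two B.fweight_inner)
  have "{j\<in>nb P i. precedes xs j i} = {}" using no_pred by blast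
  then have source_root: "sroot C P i = \<alpha> P i"
    using B.slice_root_recursion[OF xs i] by (simp only: sum.empty add_0_right)
  \<comment> \<open>At a source, subtracting the simple root subtracts the slice root, which is what
    \<open>C\<close> does to the old weight. Hence the new slice root at \<open>i\<close> is the
    image of the old one under \<open>C\<close>.\<close>
  have Cw: "C (B.\<omega> i) = B1.\<omega> i"
    using w1'[OF i] by (simp flip: source_root add: slice_root_def)
  show "sroot C P1 k = (if k = i then C (sroot C P i) else sroot C P k)" if k: "k \<in> I" for k
  proof (cases "k = i")
    case True
    then show ?thesis
      by (simp add: slice_root_def Cw[symmetric] linear_diff[OF B.linear_factorization[OF xs]])
  next
    case False
    then show ?thesis using w1'[OF k] by (simp add: slice_root_def)
  qed
qed

lemma slice_cong:
  assumes "slice C P s" "\<And>i. i \<in> I \<Longrightarrow> s i = t i"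
  shows "slice C P t"
proof -
  from assms(1) obtain xs where xs: "simple_system R P" "factorization I (\<alpha> P) C xs"
      "simply_laced_base.slice_height I (\<alpha> P) xs s"
    by (auto simp: slice_def)
  interpret B: simply_laced_base R I "\<alpha> P" by (rule base[OF xs(1)])
  have "B.slice_height xs t"
    using xs(3) assms(2) B.nb_subset unfolding B.slice_height_def by (metis subsetD)
  then show ?thesis using xs unfolding slice_def by blast
qed

text \<open>Any higher height function of the same parity is reached by successively raising a vertex that is
  lowest among those still to be raised: such a vertex is a source.\<close>
lemma slice_raise:
  assumes "slice C P s" "\<And>i. i \<in> I \<Longrightarrow> s i \<le> t i \<and> even (t i - s i)"
    and "\<And>i j. i \<in> I \<Longrightarrow> j \<in> nb P i \<Longrightarrow> t j = t i + 1 \<or> t i = t j + 1"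
  shows "\<exists>P'. slice C P' t \<and> (\<forall>k\<in>I. nb P' k = nb P k \<and>
    sroot C P' k = (C ^^ nat ((t k - s k) div 2)) (sroot C P k))"
  using assms
proof (induction "nat (\<Sum>i\<in>I. t i - s i)" arbitrary: P s rule: less_induct)
  case less
  have P: "simple_system R P" using less.prems(1) by (simp add: slice_def)
  interpret B: simply_laced_base R I "\<alpha> P" by (rule base[OF P])
  define D where "D = {i\<in>I. s i < t i}"
  show ?case
  proof (cases "D = {}")
    case True
    then have "s i = t i" if "i \<in> I" for i using that less.prems(2)[OF that] by (force simp: D_def)
    then show ?thesis using slice_cong[OF less.prems(1), of t] by (intro exI[of _ P]) simp
  next
    case False
    have "finite D" using B.finite_I by (simp add: D_def)
    then have "Min (s ` D) \<in> s ` D" "\<And>j. j \<in> D \<Longrightarrow> Min (s ` D) \<le> s j" using False by auto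
    then obtain i where iD: "i \<in> D" and min: "\<And>j. j \<in> D \<Longrightarrow> s i \<le> s j" by force
    then have i: "i \<in> I" "s i < t i" by (auto simp: D_def)
    \<comment> \<open>The gap is positive and even, so raising by 2 does not overshoot.\<close>
    have ti: "s i + 2 \<le> t i"
    proof -
      have "t i - s i \<noteq> 1" using less.prems(2)[OF i(1)] by (metis odd_one)
      then show ?thesis using i(2) by linarith
    qed
    have source: "s j = s i + 1" if j: "j \<in> nb P i" for j
    proof (rule ccontr)
      assume "s j \<noteq> s i + 1"
      then have sj: "s i = s j + 1" using slice_nb_cases[OF less.prems(1) i(1) j] by blast
      have "j \<in> I" using j B.nb_subset by blast
      \<comment> \<open>The lower neighbour \<open>j\<close> would have to be raised as well, since
        \<open>t j \<ge> t i - 1 > s j\<close>; this contradicts the minimality of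
        \<open>s i\<close>.\<close>
      moreover have "s j < t j" using less.prems(3)[OF i(1) j] sj ti by linarith
      ultimately have "j \<in> D" by (simp add: D_def)
      then show False using min[of j] sj by simp
    qed
    define P1 where "P1 = refl_root (\<alpha> P i) ` P"
    define s1 where "s1 = s(i := s i + 2)"
    have 1: "slice C P1 s1" unfolding P1_def s1_def by (rule source_reflection(1)[OF less.prems(1) i(1) source])
    have 2: "nb P1 k = nb P k" if "k \<in> I" for k
      unfolding P1_def using source_reflection(2)[OF less.prems(1) i(1) source that] .
    have 3: "sroot C P1 k = (if k = i then C (sroot C P i) else sroot C P k)" if "k \<in> I" for k
      unfolding P1_def using source_reflection(3)[OF less.prems(1) i(1) source that] .
    have bounds: "s1 k \<le> t k \<and> even (t k - s1 k)" if "k \<in> I" for k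
      using less.prems(2)[OF that] ti by (auto simp: s1_def)
    have "(\<Sum>k\<in>I. t k - s1 k) < (\<Sum>k\<in>I. t k - s k)"
      using i(1) B.finite_I by (intro sum_strict_mono_ex1) (auto simp: s1_def)
    moreover have "(\<Sum>k\<in>I. t k - s1 k) \<ge> 0" using bounds by (intro sum_nonneg) force
    ultimately have "nat (\<Sum>k\<in>I. t k - s1 k) < nat (\<Sum>k\<in>I. t k - s k)" by linarith
    then obtain P' where P': "slice C P' t" "\<And>k. k \<in> I \<Longrightarrow> nb P' k = nb P1 k"
        "\<And>k. k \<in> I \<Longrightarrow> sroot C P' k = (C ^^ nat ((t k - s1 k) div 2)) (sroot C P1 k)"
      using less.hyps[OF _ 1 bounds] less.prems(3) 2 by blast
    have "sroot C P' k = (C ^^ nat ((t k - s k) div 2)) (sroot C P k)" if k: "k \<in> I" for k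
    proof (cases "k = i")
      case True
      have "(t i - s i) div 2 = (t i - s1 i) div 2 + 1" "(t i - s1 i) div 2 \<ge> 0"
        using ti by (auto simp: s1_def)
      then have "nat ((t i - s i) div 2) = Suc (nat ((t i - s1 i) div 2))" by linarith
      then show ?thesis using P'(3)[OF k] 3[OF k] True by (simp add: funpow_swap1)
    next
      case False
      then show ?thesis using P'(3)[OF k] 3[OF k] by (simp add: s1_def)
    qed
    then show ?thesis using P' 2 by (intro exI[of _ P']) simp
  qed
qed

end

section \<open>The bijection\<close>

lemma of_int_bit_eq_0_iff: "(of_int n :: bit) = 0 \<longleftrightarrow> even n"
  by (cases "even n") (auto elim!: evenE oddE)

section \<open>Transport and uniqueness of the labelling\<close>

context indexed_root_system
begin

context
  fixes C :: "'a \<Rightarrow> 'a" and p :: "'i \<Rightarrow> bit" and i\<^sub>0 :: 'i and \<Phi>\<^sub>0 :: "'a \<Rightarrow> 'i \<times> int"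
    and P :: "'a set" and s :: "'i \<Rightarrow> int"
  assumes sl: "slice C P s"
begin

private abbreviation "h \<equiv> map_order C"
private abbreviation "Phi \<Phi> \<equiv> is_Phi R I \<alpha> C p i\<^sub>0 \<Phi>\<^sub>0 P \<Phi>"

private lemma Phi_facts:
  assumes "Phi \<Phi>"
  shows "bij_betw \<Phi> R (I_hat I p h)"
    and "b \<in> R \<Longrightarrow> \<Phi> (C b) = tau h (\<Phi> b)"
    and "i \<in> I \<Longrightarrow> \<Phi> (sroot C P i) \<in> {i} \<times> Z2h h"
    and "arrow I \<alpha> C P i j \<Longrightarrow> \<Phi> (sroot C P i) = (i, n) \<Longrightarrow>
      \<Phi> (sroot C P j) = (j, (n + 1) mod (2 * int h))"
proof -
  note * = assms[unfolded is_Phi_def Let_def]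
  show "bij_betw \<Phi> R (I_hat I p h)" using * by blast
  show "\<Phi> (C b) = tau h (\<Phi> b)" if "b \<in> R" using * that by blast
  show "\<Phi> (sroot C P i) \<in> {i} \<times> Z2h h" if "i \<in> I"
    using * slice_beta[OF sl that] that by metis
  show "\<Phi> (sroot C P j) = (j, (n + 1) mod (2 * int h))"
    if arr: "arrow I \<alpha> C P i j" and n: "\<Phi> (sroot C P i) = (i, n)"
  proof -
    have "i \<in> I" "j \<in> I" using arr by (auto simp: arrow_def)
    then show ?thesis using * arr n slice_beta[OF sl] by metis
  qed
qed

lemma is_Phi_funpow:
  assumes Phi: "Phi \<Phi>" and b: "b \<in> R" "\<Phi> b = (i, n)" "n \<in> Z2h h"
  shows "(C ^^ m) b \<in> R \<and> \<Phi> ((C ^^ m) b) = (i, (n + 2 * int m) mod (2 * int h))"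
proof (induction m)
  case 0
  then show ?case using b by (simp add: Z2h_def)
next
  case (Suc m)
  then have "\<Phi> (C ((C ^^ m) b)) = (i, ((n + 2 * int m) mod (2 * int h) + 2) mod (2 * int h))"
    using Phi_facts(2)[OF Phi, of "(C ^^ m) b"] by (simp add: tau_def)
  also have "((n + 2 * int m) mod (2 * int h) + 2) mod (2 * int h) = (n + 2 * int m + 2) mod (2 * int h)"
    by (rule mod_add_left_eq)
  also have "n + 2 * int m + 2 = n + 2 * int (Suc m)" by simp
  finally show ?case using Suc slice_preserves_R[OF sl] by simp
qed

text \<open>Let \<open>N\<close> be the labels of the old slice roots. Modulo \<open>2 * h\<close>
  the difference \<open>N - s\<close> is the same at neighbours. As \<open>C\<close> raises labels
  by 2, the new slice roots have labels \<open>N + t - s\<close>, which grow by 1 along the arrows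
  of \<open>P'\<close> because \<open>t\<close> does.\<close>

lemma is_Phi_transfer:
  assumes Phi: "Phi \<Phi>" and i0: "i\<^sub>0 \<in> I" and sl': "slice C P' t"
    and le: "\<And>i. i \<in> I \<Longrightarrow> s i \<le> t i \<and> even (t i - s i)"
    and nb: "\<And>k. k \<in> I \<Longrightarrow> nb P' k = nb P k"
    and sroot: "\<And>k. k \<in> I \<Longrightarrow> sroot C P' k = (C ^^ nat ((t k - s k) div 2)) (sroot C P k)"
  shows "is_Phi R I \<alpha> C p i\<^sub>0 \<Phi>\<^sub>0 P' \<Phi>"
proof -
  define N where "N k = snd (\<Phi> (sroot C P k))" for k
  have N: "\<Phi> (sroot C P k) = (k, N k)" "N k \<in> Z2h h" if "k \<in> I" for k
    using Phi_facts(3)[OF Phi that] by (auto simp: N_def)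
  have N_nb: "(N j - N i - (s j - s i)) mod (2 * int h) = 0" if i: "i \<in> I" and j: "j \<in> nb P i" for i j
  proof -
    have j': "j \<in> I" using j by (simp add: nbrs_def)
    from slice_nb_cases[OF sl i j] show ?thesis
    proof (elim disjE conjE)
      assume "s j = s i + 1" "arrow I \<alpha> C P i j"
      then have "N j = (N i + 1) mod (2 * int h)"
        using Phi_facts(4)[OF Phi _ N(1)[OF i]] N(1)[OF j'] by simp
      then show ?thesis using \<open>s j = s i + 1\<close> by (simp add: mod_diff_left_eq diff_diff_eq)
    next
      assume "s i = s j + 1" "arrow I \<alpha> C P j i"
      then have "N i = (N j + 1) mod (2 * int h)"
        using Phi_facts(4)[OF Phi _ N(1)[OF j']] N(1)[OF i] by simp
      then have "(N j - N i + 1) mod (2 * int h) = (N j + 1 - (N j + 1) mod (2 * int h)) mod (2 * int h)"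
        by (simp add: algebra_simps)
      also have "\<dots> = 0" by (simp add: mod_diff_right_eq)
      finally show ?thesis using \<open>s i = s j + 1\<close> by simp
    qed
  qed
  have val: "\<Phi> (sroot C P' k) = (k, (N k + (t k - s k)) mod (2 * int h))" if k: "k \<in> I" for k
  proof -
    have "2 * int (nat ((t k - s k) div 2)) = t k - s k" using le[OF k] by simp
    then show ?thesis
      using is_Phi_funpow[OF Phi slice_root_in_R[OF sl k] N(1)[OF k] N(2)[OF k]] sroot[OF k] by simp
  qed
  have "h > 0" using N(2)[OF i0] by (auto simp: Z2h_def)
  show ?thesis
    unfolding is_Phi_def Let_def
  proof (intro conjI ballI allI impI)
    show "bij_betw \<Phi> R (I_hat I p h)" by (rule Phi_facts(1)[OF Phi])
    show "\<Phi> (C b) = tau h (\<Phi> b)" if "b \<in> R" for b by (rule Phi_facts(2)[OF Phi that])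
    show "\<Phi> (beta I \<alpha> C P' i) \<in> {i} \<times> Z2h h" if "i \<in> I" for i
      using val[OF that] slice_beta[OF sl' that] \<open>h > 0\<close> by (simp add: Z2h_def)
    show "\<Phi> (beta I \<alpha> C P' j) = (j, (n + 1) mod (2 * int h))"
      if "arrow I \<alpha> C P' i j \<and> \<Phi> (beta I \<alpha> C P' i) = (i, n)" for i j n
    proof -
      have ar: "arrow I \<alpha> C P' i j" and n: "\<Phi> (beta I \<alpha> C P' i) = (i, n)" using that by auto
      have i: "i \<in> I" and j: "j \<in> nb P i" and t: "t j = t i + 1"
        using arrow_height[OF sl' ar] nb by auto
      have j': "j \<in> I" using j by (simp add: nbrs_def)
      have "n = (N i + (t i - s i)) mod (2 * int h)" using val[OF i] n slice_beta[OF sl' i] by simp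
      then have "(n + 1) mod (2 * int h) = (N i + (t i - s i) + 1) mod (2 * int h)"
        by (simp add: mod_add_left_eq)
      also have "\<dots> = (N j + (t j - s j)) mod (2 * int h)"
      proof (rule sym)
        have "N j + (t j - s j) = (N i + (t i - s i) + 1) + (N j - N i - (s j - s i))" using t by simp
        then show "(N j + (t j - s j)) mod (2 * int h) = (N i + (t i - s i) + 1) mod (2 * int h)"
          using N_nb[OF i j] by (metis add.right_neutral mod_add_right_eq)
      qed
      finally show ?thesis using val[OF j'] slice_beta[OF sl' j'] by simp
    qed
    show "\<Phi> b = \<Phi>\<^sub>0 b" if b: "b \<in> C_orbit C (beta I \<alpha> C P' i\<^sub>0)" for b
    proof -
      obtain k where "b = (C ^^ k) (sroot C P' i\<^sub>0)"
        using b slice_beta[OF sl' i0] by (auto simp: C_orbit_def)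
      \<comment> \<open>The orbit of the new root at \<open>i\<^sub>0\<close> lies in that of the
        old one, where the values are prescribed already.\<close>
      then have "b = (C ^^ (k + nat ((t i\<^sub>0 - s i\<^sub>0) div 2))) (beta I \<alpha> C P i\<^sub>0)"
        using sroot[OF i0] slice_beta[OF sl i0] by (simp add: funpow_add)
      then have "b \<in> C_orbit C (beta I \<alpha> C P i\<^sub>0)" by (auto simp: C_orbit_def)
      then show ?thesis using Phi unfolding is_Phi_def Let_def by blast
    qed
  qed
qed

text \<open>Agreement at \<open>i\<^sub>0\<close> spreads along edges in both directions, hence over
  the connected diagram, to all slice roots. By parity and injectivity every root is a power of
  \<open>C\<close> applied to a slice root, and equivariance finishes.\<close>

lemma is_Phi_unique:
  assumes Phi: "Phi \<Phi>" and Phi': "Phi \<Phi>'" and i0: "i\<^sub>0 \<in> I" and b: "b \<in> R"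
  shows "\<Phi> b = \<Phi>' b"
proof -
  have P: "simple_system R P" using sl by (simp add: slice_def)
  interpret B: simply_laced_base R I "\<alpha> P" by (rule base[OF P])
  define J where "J = {i\<in>I. \<Phi> (sroot C P i) = \<Phi>' (sroot C P i)}"
  have "sroot C P i\<^sub>0 \<in> C_orbit C (beta I \<alpha> C P i\<^sub>0)"
    using slice_beta[OF sl i0] by (auto simp: C_orbit_def intro!: exI[of _ 0])
  then have "\<Phi> (sroot C P i\<^sub>0) = \<Phi>\<^sub>0 (sroot C P i\<^sub>0)" "\<Phi>' (sroot C P i\<^sub>0) = \<Phi>\<^sub>0 (sroot C P i\<^sub>0)"
    using Phi Phi' unfolding is_Phi_def Let_def by blast+
  then have "i\<^sub>0 \<in> J" using i0 by (simp add: J_def)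
  moreover have "nb P i \<subseteq> J" if iJ: "i \<in> J" for i
  proof
    fix j assume j: "j \<in> nb P i"
    have i: "i \<in> I" and eq: "\<Phi> (sroot C P i) = \<Phi>' (sroot C P i)" using iJ by (auto simp: J_def)
    have j': "j \<in> I" using j by (simp add: nbrs_def)
    from slice_nb_cases[OF sl i j] have "\<Phi> (sroot C P j) = \<Phi>' (sroot C P j)"
    proof (elim disjE conjE)
      assume ar: "arrow I \<alpha> C P i j"
      obtain n where "\<Phi> (sroot C P i) = (i, n)" using Phi_facts(3)[OF Phi i] by auto
      then show ?thesis using Phi_facts(4)[OF Phi ar] Phi_facts(4)[OF Phi' ar] eq by simp
    next
      assume ar: "arrow I \<alpha> C P j i"
      obtain n where n: "\<Phi> (sroot C P j) = (j, n)" "n \<in> Z2h h" using Phi_facts(3)[OF Phi j'] by auto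
      obtain n' where n': "\<Phi>' (sroot C P j) = (j, n')" "n' \<in> Z2h h" using Phi_facts(3)[OF Phi' j'] by auto
      have "(n + 1) mod (2 * int h) = (n' + 1) mod (2 * int h)"
        using Phi_facts(4)[OF Phi ar n(1)] Phi_facts(4)[OF Phi' ar n'(1)] eq by simp
      then have "(n + 1 - 1) mod (2 * int h) = (n' + 1 - 1) mod (2 * int h)"
        by (metis mod_diff_left_eq)
      then show ?thesis using n n' by (simp add: Z2h_def)
    qed
    then show "j \<in> J" using j' by (simp add: J_def)
  qed
  ultimately have "J = I" using B.diagram_connected[OF irreducible, of J] by (auto simp: J_def)
  obtain i m where im: "\<Phi> b = (i, m)" by force
  have "\<Phi> b \<in> I_hat I p h" using Phi_facts(1)[OF Phi] b by (auto simp: bij_betw_def)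
  then have i: "i \<in> I" and m: "m \<in> Z2h h" "p i + of_int m = 0" using im by (auto simp: I_hat_def)
  obtain n where n: "\<Phi> (sroot C P i) = (i, n)" "n \<in> Z2h h" using Phi_facts(3)[OF Phi i] by auto
  have bR: "sroot C P i \<in> R" by (rule slice_root_in_R[OF sl i])
  then have "\<Phi> (sroot C P i) \<in> I_hat I p h" using Phi_facts(1)[OF Phi] by (auto simp: bij_betw_def)
  then have "p i + of_int n = 0" using n by (auto simp: I_hat_def)
  then have "of_int (m - n) = (0::bit)" using m(2) by (metis add_left_cancel diff_self of_int_diff)
  then have "even (m - n)" by (simp only: of_int_bit_eq_0_iff)
  \<comment> \<open>Labels over the same \<open>i\<close> have equal parity, so the residue of
    \<open>m - n\<close> is even and \<open>k\<close> steps of \<open>C\<close> lead from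
    \<open>n\<close> to \<open>m\<close>.\<close>
  define k where "k = nat (((m - n) mod (2 * int h)) div 2)"
  have "h > 0" using m by (auto simp: Z2h_def)
  then have "(m - n) mod (2 * int h) \<ge> 0" "even ((m - n) mod (2 * int h))"
    using \<open>even (m - n)\<close> by (auto simp: dvd_mod_iff)
  then have "2 * int k = (m - n) mod (2 * int h)" by (simp add: k_def)
  then have k: "(n + 2 * int k) mod (2 * int h) = m"
    using m by (simp add: mod_add_right_eq Z2h_def)
  have "\<Phi> ((C ^^ k) (sroot C P i)) = \<Phi> b" "(C ^^ k) (sroot C P i) \<in> R"
    using is_Phi_funpow[OF Phi bR n, of k] k im by auto
  then have "b = (C ^^ k) (sroot C P i)"
    using Phi_facts(1)[OF Phi] b unfolding bij_betw_def inj_on_def by metis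
  moreover have "\<Phi>' (sroot C P i) = (i, n)" 
  proof -
    have "i \<in> J" using i \<open>J = I\<close> by simp
    then show ?thesis using n by (simp add: J_def)
  qed
  ultimately show ?thesis using is_Phi_funpow[OF Phi' bR _ n(2), of i k] k im by simp
qed

end

section \<open>Moving two simple systems to a common one\<close>

lemma slice_bipartite:
  assumes sl: "slice C P s" and M: "\<And>i. i \<in> I \<Longrightarrow> s i \<le> M" and i0: "i\<^sub>0 \<in> I"
  obtains P' t where "slice C P' t" "\<And>i. i \<in> I \<Longrightarrow> t i \<in> {M, M + 1}"
    "\<And>k. k \<in> I \<Longrightarrow> nb P' k = nb P k"
    "\<And>(f :: 'a \<Rightarrow> complex) \<theta> k. (\<And>x. f (C x) = cis (2 * \<theta>) * f x) \<Longrightarrow> k \<in> I \<Longrightarrow>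
      f (sroot C P' k) = cis (\<theta> * (t k - s k)) * f (sroot C P k)"
    "\<And>p \<Phi>\<^sub>0 \<Phi>. is_Phi R I \<alpha> C p i\<^sub>0 \<Phi>\<^sub>0 P \<Phi> \<Longrightarrow> is_Phi R I \<alpha> C p i\<^sub>0 \<Phi>\<^sub>0 P' \<Phi>"
proof -
  \<comment> \<open>Each vertex goes to the level that has its parity; heights of neighbours differ
    by 1, so neighbours land on different levels.\<close>
  define t where "t i = (if even (M - s i) then M else M + 1)" for i
  have le: "s i \<le> t i \<and> even (t i - s i)" if "i \<in> I" for i
    using M[OF that] by (auto simp: t_def)
  have "t j = t i + 1 \<or> t i = t j + 1" if "i \<in> I" "j \<in> nb P i" for i j
    using slice_nb_cases[OF sl that] by (auto simp: t_def)
  then obtain P' where P': "slice C P' t" "\<And>k. k \<in> I \<Longrightarrow> nb P' k = nb P k"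
      "\<And>k. k \<in> I \<Longrightarrow> sroot C P' k = (C ^^ nat ((t k - s k) div 2)) (sroot C P k)"
    using slice_raise[OF sl le] by blast
  have eig: "f (sroot C P' k) = cis (\<theta> * (t k - s k)) * f (sroot C P k)"
    if f: "\<And>x. f (C x) = cis (2 * \<theta>) * f x" and k: "k \<in> I" for f :: "'a \<Rightarrow> complex" and \<theta> k
  proof -
    have pow: "f ((C ^^ n) x) = cis (2 * \<theta> * n) * f x" for n x
      by (induction n) (simp_all add: f mult.assoc[symmetric] cis_mult distrib_left add.commute)
    have "2 * int (nat ((t k - s k) div 2)) = t k - s k" using le[OF k] by simp
    then have "2 * real (nat ((t k - s k) div 2)) = t k - s k"
      by (metis of_int_mult of_int_numeral of_int_of_nat_eq)
    then have "2 * \<theta> * real (nat ((t k - s k) div 2)) = \<theta> * (t k - s k)"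
      by (metis mult.assoc mult.commute)
    then show ?thesis unfolding P'(3)[OF k] pow by (simp only:)
  qed
  show ?thesis
  proof (rule that[OF P'(1) _ P'(2)])
    show "t i \<in> {M, M + 1}" for i by (simp add: t_def)
  qed (use eig is_Phi_transfer[OF sl _ i0 P'(1) le P'(2,3)] in blast)+
qed

lemma slice_height_bounded: "slice C P s \<Longrightarrow> \<exists>K. \<forall>i\<in>I. s i \<le> K"
proof -
  assume "slice C P s"
  then have "finite I" using base simply_laced_base.finite_I by (auto simp: slice_def)
  then show ?thesis by (metis Max_ge finite_imageI imageI)
qed

text \<open>Two slices of the same Coxeter element can be moved to the same simple system: after moving both to
  bipartite position at suitable levels, one half-plane of the Coxeter plane defines the positive
  roots of both.\<close>
lemma slices_meet:
  assumes sl: "slice C P s" and sl': "slice C P' s'" and i0: "i\<^sub>0 \<in> I"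
  obtains Q t where "slice C Q t"
    "\<And>p \<Phi>\<^sub>0 \<Phi>. is_Phi R I \<alpha> C p i\<^sub>0 \<Phi>\<^sub>0 P \<Phi> \<Longrightarrow> is_Phi R I \<alpha> C p i\<^sub>0 \<Phi>\<^sub>0 Q \<Phi>"
    "\<And>p \<Phi>\<^sub>0 \<Phi>. is_Phi R I \<alpha> C p i\<^sub>0 \<Phi>\<^sub>0 P' \<Phi> \<Longrightarrow> is_Phi R I \<alpha> C p i\<^sub>0 \<Phi>\<^sub>0 Q \<Phi>"
proof -
  obtain xs where xs: "simple_system R P" "factorization I (\<alpha> P) C xs"
      "simply_laced_base.slice_height I (\<alpha> P) xs s" using sl by (auto simp: slice_def)
  obtain xs' where xs': "simple_system R P'" "factorization I (\<alpha> P') C xs'"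
      "simply_laced_base.slice_height I (\<alpha> P') xs' s'" using sl' by (auto simp: slice_def)
  obtain \<theta> :: real and f :: "'a \<Rightarrow> complex" and g g' :: "'i \<Rightarrow> real" and r \<psi> :: real
    where th: "0 < \<theta>" "\<theta> \<le> pi / 2" and f: "linear f" and fC: "\<forall>x. f (C x) = cis (2 * \<theta>) * f x"
    and g: "\<forall>i\<in>I. g i > 0" "\<forall>i\<in>I. g' i > 0" and r: "r > 0"
    and eig: "\<forall>i\<in>I. 2 * cos \<theta> * g i = (\<Sum>j\<in>nb P i. g j)"
      "\<forall>i\<in>I. 2 * cos \<theta> * g' i = (\<Sum>j\<in>nb P' i. g' j)"
    and fs: "\<forall>i\<in>I. f (sroot C P i) = cis (\<theta> * s i) * g i"
      "\<forall>i\<in>I. f (sroot C P' i) = rcis r (\<psi> + \<theta> * s' i) * g' i"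
    by (rule common_eigenfunctional[OF base[OF xs(1)] base[OF xs'(1)] irreducible xs(2,3) xs'(2,3) i0])
  obtain M where M: "\<And>i. i \<in> I \<Longrightarrow> s i \<le> M" using slice_height_bounded[OF sl] by blast
  obtain K where K: "\<And>i. i \<in> I \<Longrightarrow> s' i \<le> K" using slice_height_bounded[OF sl'] by blast
  obtain M' :: int and m :: nat and \<phi> :: real where dir: "M' \<ge> K" "\<theta> * (M - 1) < \<phi>" "\<phi> < \<theta> * M"
    "\<theta> * (M' - 1) + \<psi> < \<phi> + 2 * pi * m" "\<phi> + 2 * pi * m < \<theta> * M' + \<psi>"
    using common_direction[OF th(1)] by metis
  obtain Q t where Q: "slice C Q t" "\<And>i. i \<in> I \<Longrightarrow> t i \<in> {M, M + 1}"
    "\<And>k. k \<in> I \<Longrightarrow> nb Q k = nb P k"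
    "\<And>k. k \<in> I \<Longrightarrow> f (sroot C Q k) = cis (\<theta> * (t k - s k)) * f (sroot C P k)"
    "\<And>p \<Phi>\<^sub>0 \<Phi>. is_Phi R I \<alpha> C p i\<^sub>0 \<Phi>\<^sub>0 P \<Phi> \<Longrightarrow> is_Phi R I \<alpha> C p i\<^sub>0 \<Phi>\<^sub>0 Q \<Phi>"
    using slice_bipartite[OF sl M i0] fC by metis
  \<comment> \<open>Source reflections only raise heights, so the target level has to bound
    \<open>s'\<close>.\<close>
  have K': "s' i \<le> M'" if "i \<in> I" for i using K[OF that] dir(1) by linarith
  obtain Q' t' where Q': "slice C Q' t'" "\<And>i. i \<in> I \<Longrightarrow> t' i \<in> {M', M' + 1}"
    "\<And>k. k \<in> I \<Longrightarrow> nb Q' k = nb P' k"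
    "\<And>k. k \<in> I \<Longrightarrow> f (sroot C Q' k) = cis (\<theta> * (t' k - s' k)) * f (sroot C P' k)"
    "\<And>p \<Phi>\<^sub>0 \<Phi>. is_Phi R I \<alpha> C p i\<^sub>0 \<Phi>\<^sub>0 P' \<Phi> \<Longrightarrow> is_Phi R I \<alpha> C p i\<^sub>0 \<Phi>\<^sub>0 Q' \<Phi>"
    using slice_bipartite[OF sl' K' i0] fC by metis
  \<comment> \<open>\<open>l\<close> is positive exactly where \<open>f\<close> takes values in the
    open half-plane to the left of the direction \<open>\<phi>\<close>.\<close>
  define l where "l x = Im (cis (- \<phi>) * f x)" for x
  have l: "linear l"
    unfolding l_def by (rule linearI) (simp_all add: linear_add[OF f] linear_cmul[OF f] algebra_simps)
  have sQ: "simple_system R Q" "simple_system R Q'" using Q(1) Q'(1) by (simp_all add: slice_def)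
  interpret B: simply_laced_base R I "\<alpha> Q" by (rule base[OF sQ(1)])
  interpret B': simply_laced_base R I "\<alpha> Q'" by (rule base[OF sQ(2)])
  have pos: "l (\<alpha> Q i) > 0" if i: "i \<in> I" for i
  proof -
    obtain ys where ys: "factorization I (\<alpha> Q) C ys" "B.slice_height ys t"
      using Q(1) by (auto simp: slice_def)
    have "f (sroot C Q k) = rcis 1 (0 + \<theta> * t k) * g k" if k: "k \<in> I" for k
      unfolding Q(4)[OF k] bspec[OF fs(1) k]
      by (simp add: rcis_def mult.assoc[symmetric] cis_mult distrib_left[symmetric])
    then show ?thesis
      unfolding l_def
      using B.bipartite_positive[OF ys f Q(2), of g \<theta> 1 0 \<phi> i] g(1) eig(1) Q(3) th dir i by simp
  qed
  have pos': "l (\<alpha> Q' i) > 0" if i: "i \<in> I" for i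
  proof -
    obtain ys where ys: "factorization I (\<alpha> Q') C ys" "B'.slice_height ys t'"
      using Q'(1) by (auto simp: slice_def)
    have "f (sroot C Q' k) = rcis r (\<psi> + \<theta> * t' k) * g' k" if k: "k \<in> I" for k
    proof -
      have "\<theta> * (t' k - s' k) + (\<psi> + \<theta> * s' k) = \<psi> + \<theta> * t' k" by (simp add: algebra_simps)
      then have "cis (\<theta> * (t' k - s' k)) * rcis r (\<psi> + \<theta> * s' k) = rcis r (\<psi> + \<theta> * t' k)"
        by (metis cis_rcis_eq mult_1 rcis_mult)
      then show ?thesis unfolding Q'(4)[OF k] bspec[OF fs(2) k] by (simp only: mult.assoc[symmetric])
    qed
    then have "Im (cis (- (\<phi> + 2 * pi * m)) * f (\<alpha> Q' i)) > 0"
      using B'.bipartite_positive[OF ys f Q'(2), of g' \<theta> r \<psi> "\<phi> + 2 * pi * m" i]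
        g(2) eig(2) Q'(3) th dir r i by simp
    \<comment> \<open>The \<open>m\<close> full turns separating the two directions do not change
      the half-plane.\<close>
    moreover have "cis (- (\<phi> + 2 * pi * m)) = cis (- \<phi>)"
    proof -
      have "cis (- \<phi>) = cis (- (\<phi> + 2 * pi * m)) * cis (2 * pi * m)"
        unfolding cis_mult by simp
      then show ?thesis by (simp add: cis_multiple_2pi)
    qed
    ultimately show ?thesis by (simp only: l_def)
  qed
  have im: "\<alpha> Q ` I = Q" "\<alpha> Q' ` I = Q'" using bij_simple sQ by (auto simp: bij_betw_def)
  have "l x > 0" if "x \<in> Q" for x using that pos im(1) by (metis imageE)
  moreover have "l x > 0" if "x \<in> Q'" for x using that pos' im(2) by (metis imageE)
  ultimately have "Q' = Q" using simple_system_unique[OF sQ(2,1) l] by simp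
  then show ?thesis using that[OF Q(1) Q(5)] Q'(5) by simp
qed

end

theorem theorem5p5:
  fixes R :: "'a::euclidean_space set"
    and I :: "'i set"
    and \<alpha> :: "'a set \<Rightarrow> 'i \<Rightarrow> 'a"
    and C :: "'a \<Rightarrow> 'a"
    and p :: "'i \<Rightarrow> bit"
    and i\<^sub>0 :: 'i
    and \<Phi>\<^sub>0 \<Phi> \<Phi>' :: "'a \<Rightarrow> 'i \<times> int"
    and P P' :: "'a set"
  assumes "root_system R" and "reduced_rs R" and "irreducible_rs R"
    and "simply_laced_normalized R"
    and "simple_root_indexing R I \<alpha>"
    and "coxeter_element R C"
    and "parity_function R I \<alpha> p"
    and "i\<^sub>0 \<in> I"
    and "base_labelling R I \<alpha> C p i\<^sub>0 \<Phi>\<^sub>0"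
    and "compatible R I \<alpha> C P" and "compatible R I \<alpha> C P'"
    and "is_Phi R I \<alpha> C p i\<^sub>0 \<Phi>\<^sub>0 P \<Phi>"
    and "is_Phi R I \<alpha> C p i\<^sub>0 \<Phi>\<^sub>0 P' \<Phi>'"
  shows "\<forall>\<beta>\<in>R. \<Phi> \<beta> = \<Phi>' \<beta>"
proof
  fix \<beta> assume "\<beta> \<in> R"
  interpret indexed_root_system R I \<alpha> by unfold_locales fact+
  obtain s where s: "slice C P s" using compatible_slice assms by blast
  obtain s' where s': "slice C P' s'" using compatible_slice assms by blast
  obtain Q t where "slice C Q t" "is_Phi R I \<alpha> C p i\<^sub>0 \<Phi>\<^sub>0 Q \<Phi>" "is_Phi R I \<alpha> C p i\<^sub>0 \<Phi>\<^sub>0 Q \<Phi>'"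
    using slices_meet[OF s s' \<open>i\<^sub>0 \<in> I\<close>] assms(12,13) by metis
  then show "\<Phi> \<beta> = \<Phi>' \<beta>" using is_Phi_unique \<open>i\<^sub>0 \<in> I\<close> \<open>\<beta> \<in> R\<close> by blast
qed

end
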